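(* Let $\mathbb{P}=\mathcal{M}_1\times\cdots\times\mathcal{M}_k$ be a product of constant-curvature model spaces (each factor a hyperbolic space $\mathbb{H}^{n_i}_{K_i}$ in the Lorentz model, a sphere $\mathbb{S}^{n_i}_{R_i}$, or a Euclidean space $\mathbb{E}^{n_i}$) with product origin $\mathbf{o}=(o_1,\dots,o_k)$. Fix $\tau_i>0$ and $V=(V_1,\dots,V_k)\in T_{\mathbf o}\mathbb{P}$, and let $f=(f_1,\dots,f_k)$ with $f_i:\mathbb{P}\times[0,T]\to[0,1]$ continuously differentiable. Consider the ODE on $\mathbb{P}$, written factorwise, $$\dot x_i(t)=\Big(\tfrac{1}{\tau_i}+f_i(x(t),t)\Big)\log_{x_i(t)}(o_i)+f_i(x(t),t)\,P_{o_i\to x_i(t)}(V_i),\qquad i=1,\dots,k,$$ with initial value $x(0)=x_0$, and the Geodesic Decay (GD) scheme with uniform step $\Delta t=T/N$, $t_j=j\Delta t$: $$x^{*}=\mathrm{Exp}_{x_j}\big(\Delta t\,(f(x_j,t_j)\odot P_{\mathbf o\to x_j}(V))\big),\qquad x_{j+1}=\mathrm{Exp}_{\mathbf o}\Big(e^{-\Delta t\,(1/\tau+f(x_j,t_j))}\odot \mathrm{Log}_{\mathbf o}(x^{*})\Big),$$ where $\odot$ multiplies the $i$-th factor component by the $i$-th scalar. Assume the exact solution $x(t)$ exists on $[0,T]$ and that the exact trajectory and all iterates and intermediate points lie in a compact region on which all exponential maps, logarithmic maps and parallel transports used above are well defined and smooth (i.e. away from cut loci). Then the GD scheme is first-order convergent: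 there are constants $C,h_0>0$ (independent of $N$) such that for all $\Delta t\le h_0$, $$\max_{0\le j\le N} d_{\mathbb{P}}\big(x_j,x(t_j)\big)\le C\,\Delta t .$$
   Context: On each factor: for the hyperbolic (Lorentz) model $\mathbb{H}^n_K=\{x\in\mathbb{R}^{n+1}:\langle x,x\rangle_{\mathcal L}=-K,x_0>0\}$ with origin $(\sqrt K,0,\dots,0)$; for the sphere $\mathbb{S}^n_R=\{p\in\mathbb{R}^{n+1}:\|p\|=R\}$ with origin $(R,0,\dots,0)$; for $\mathbb{E}^n$ origin $0$. $\exp_x,\log_x$ denote the Riemannian exponential and logarithm maps, $P_{x\to y}$ Levi-Civita parallel transport along the minimizing geodesic. On $\mathbb{P}$, $\mathrm{Exp},\mathrm{Log}$ and $P$ act factorwise, and $d_{\mathbb{P}}(x,y)=\sum_i d_{\mathcal{M}_i}(x_i,y_i)$ is the sum of factor geodesic distances. *)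

theory Defs
  imports "HOL-Analysis.Analysis"
begin

text \<open>
Conventions.  Every factor of the product lives inside a common ambient space
real^'m::{finite,enum} (zero padding): ambient coordinate number j (j = 0, 1, ...) of the
model R^(n+1) (resp. R^n) is the coordinate cidx j = (enum ! j) of real^'m::{finite,enum};
all other coordinates are 0.  Coordinate number 0 is the time-like coordinate
of the Lorentz model.  A point of the product P = M_1 x ... x M_k is a
matrix X :: real^'m::{finite,enum}^'k, its i-th factor component being X$i.
\<close>

datatype model = Hyp real nat   \<comment> \<open>Hyp K n : H^n_K, Lorentz model in R^(n+1)\<close>
               | Sph real nat   \<comment> \<open>Sph R n : S^n_R in R^(n+1)\<close>
               | Euc nat

definition cidx :: "nat \<Rightarrow> 'm::{finite,enum}" where
  "cidx j = (Enum.enum :: 'm::{finite,enum} list) ! j"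

fun adim :: "model \<Rightarrow> nat" where
  "adim (Hyp K n) = n + 1"
| "adim (Sph R n) = n + 1"
| "adim (Euc n) = n"

fun valid_model :: "model \<Rightarrow> nat \<Rightarrow> bool" where
  "valid_model (Hyp K n) c = (K > 0 \<and> n \<ge> 1 \<and> n + 1 \<le> c)"
| "valid_model (Sph R n) c = (R > 0 \<and> n \<ge> 1 \<and> n + 1 \<le> c)"
| "valid_model (Euc n) c = (n \<ge> 1 \<and> n \<le> c)"

definition ambient :: "model \<Rightarrow> (real^'m::{finite,enum}) set" where
  "ambient M = {x. \<forall>c. c \<notin> cidx ` {..<adim M} \<longrightarrow> x $ c = 0}"

text \<open>Lorentz inner product -x_0 y_0 + x_1 y_1 + ... (on zero-padded vectors).\<close>
definition linner :: "real^'m::{finite,enum} \<Rightarrow> real^'m::{finite,enum} \<Rightarrow> real" where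
  "linner x y = x \<bullet> y - 2 * (x $ cidx 0) * (y $ cidx 0)"

fun carrier :: "model \<Rightarrow> (real^'m::{finite,enum}) set" where
  "carrier (Hyp K n) = {x \<in> ambient (Hyp K n). linner x x = - K \<and> x $ cidx 0 > 0}"
| "carrier (Sph R n) = {x \<in> ambient (Sph R n). norm x = R}"
| "carrier (Euc n) = ambient (Euc n)"

fun origin :: "model \<Rightarrow> real^'m::{finite,enum}" where
  "origin (Hyp K n) = (\<chi> c. if c = cidx 0 then sqrt K else 0)"
| "origin (Sph R n) = (\<chi> c. if c = cidx 0 then R else 0)"
| "origin (Euc n) = 0"

fun tangent :: "model \<Rightarrow> real^'m::{finite,enum} \<Rightarrow> (real^'m::{finite,enum}) set" where
  "tangent (Hyp K n) x = {v \<in> ambient (Hyp K n). linner x v = 0}"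
| "tangent (Sph R n) x = {v \<in> ambient (Sph R n). x \<bullet> v = 0}"
| "tangent (Euc n) x = ambient (Euc n)"

fun gdist :: "model \<Rightarrow> real^'m::{finite,enum} \<Rightarrow> real^'m::{finite,enum} \<Rightarrow> real" where
  "gdist (Hyp K n) x y = sqrt K * arcosh (- linner x y / K)"
| "gdist (Sph R n) x y = R * arccos ((x \<bullet> y) / R\<^sup>2)"
| "gdist (Euc n) x y = norm (x - y)"

fun rexp :: "model \<Rightarrow> real^'m::{finite,enum} \<Rightarrow> real^'m::{finite,enum} \<Rightarrow> real^'m::{finite,enum}" where
  "rexp (Hyp K n) x v =
     (let nv = sqrt (linner v v) in
      if nv = 0 then x
      else cosh (nv / sqrt K) *\<^sub>R x + (sqrt K * sinh (nv / sqrt K) / nv) *\<^sub>R v)"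
| "rexp (Sph R n) x v =
     (let nv = norm v in
      if nv = 0 then x
      else cos (nv / R) *\<^sub>R x + (R * sin (nv / R) / nv) *\<^sub>R v)"
| "rexp (Euc n) x v = x + v"

fun rlog :: "model \<Rightarrow> real^'m::{finite,enum} \<Rightarrow> real^'m::{finite,enum} \<Rightarrow> real^'m::{finite,enum}" where
  "rlog (Hyp K n) x y =
     (let u = y + (linner x y / K) *\<^sub>R x in
      if y = x then 0 else (gdist (Hyp K n) x y / sqrt (linner u u)) *\<^sub>R u)"
| "rlog (Sph R n) x y =
     (let u = y - ((x \<bullet> y) / R\<^sup>2) *\<^sub>R x in
      if u = 0 then 0 else (gdist (Sph R n) x y / norm u) *\<^sub>R u)"
| "rlog (Euc n) x y = y - x"

text \<open>Levi-Civita parallel transport P_{x->y}(v) along the minimizing geodesic.\<close>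
fun ptrans :: "model \<Rightarrow> real^'m::{finite,enum} \<Rightarrow> real^'m::{finite,enum} \<Rightarrow> real^'m::{finite,enum} \<Rightarrow> real^'m::{finite,enum}" where
  "ptrans (Hyp K n) x y v = v + (linner y v / (K - linner x y)) *\<^sub>R (x + y)"
| "ptrans (Sph R n) x y v = v - ((y \<bullet> v) / (R\<^sup>2 + x \<bullet> y)) *\<^sub>R (x + y)"
| "ptrans (Euc n) x y v = v"

definition pcarrier :: "('k::finite \<Rightarrow> model) \<Rightarrow> (real^'m::{finite,enum}^'k) set" where
  "pcarrier g = {X. \<forall>i. X $ i \<in> carrier (g i)}"

definition porigin :: "('k::finite \<Rightarrow> model) \<Rightarrow> real^'m::{finite,enum}^'k" where
  "porigin g = (\<chi> i. origin (g i))"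

definition pdist :: "('k::finite \<Rightarrow> model) \<Rightarrow> real^'m::{finite,enum}^'k \<Rightarrow> real^'m::{finite,enum}^'k \<Rightarrow> real" where
  "pdist g X Y = (\<Sum>i\<in>UNIV. gdist (g i) (X $ i) (Y $ i))"

definition pexp :: "('k::finite \<Rightarrow> model) \<Rightarrow> real^'m::{finite,enum}^'k \<Rightarrow> real^'m::{finite,enum}^'k \<Rightarrow> real^'m::{finite,enum}^'k" where
  "pexp g X W = (\<chi> i. rexp (g i) (X $ i) (W $ i))"

definition plog :: "('k::finite \<Rightarrow> model) \<Rightarrow> real^'m::{finite,enum}^'k \<Rightarrow> real^'m::{finite,enum}^'k \<Rightarrow> real^'m::{finite,enum}^'k" where
  "plog g X Y = (\<chi> i. rlog (g i) (X $ i) (Y $ i))"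

definition ptransP :: "('k::finite \<Rightarrow> model) \<Rightarrow> real^'m::{finite,enum}^'k \<Rightarrow> real^'m::{finite,enum}^'k \<Rightarrow> real^'m::{finite,enum}^'k \<Rightarrow> real^'m::{finite,enum}^'k" where
  "ptransP g X Y W = (\<chi> i. ptrans (g i) (X $ i) (Y $ i) (W $ i))"

definition odot :: "('k::finite \<Rightarrow> real) \<Rightarrow> real^'m::{finite,enum}^'k \<Rightarrow> real^'m::{finite,enum}^'k" where
  "odot a W = (\<chi> i. a i *\<^sub>R W $ i)"

definition ode_rhs ::
  "('k::finite \<Rightarrow> model) \<Rightarrow> ('k \<Rightarrow> real) \<Rightarrow> ('k \<Rightarrow> real^'m::{finite,enum}^'k \<Rightarrow> real \<Rightarrow> real)
   \<Rightarrow> real^'m::{finite,enum}^'k \<Rightarrow> real^'m::{finite,enum}^'k \<Rightarrow> real \<Rightarrow> real^'m::{finite,enum}^'k" where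
  "ode_rhs g \<tau> f V X t =
     (\<chi> i. (1 / \<tau> i + f i X t) *\<^sub>R rlog (g i) (X $ i) (origin (g i))
           + f i X t *\<^sub>R ptrans (g i) (origin (g i)) (X $ i) (V $ i))"

definition gd_mid ::
  "('k::finite \<Rightarrow> model) \<Rightarrow> ('k \<Rightarrow> real^'m::{finite,enum}^'k \<Rightarrow> real \<Rightarrow> real)
   \<Rightarrow> real^'m::{finite,enum}^'k \<Rightarrow> real \<Rightarrow> real^'m::{finite,enum}^'k \<Rightarrow> real \<Rightarrow> real^'m::{finite,enum}^'k" where
  "gd_mid g f V h X t =
     pexp g X (h *\<^sub>R odot (\<lambda>i. f i X t) (ptransP g (porigin g) X V))"

definition gd_step ::
  "('k::finite \<Rightarrow> model) \<Rightarrow> ('k \<Rightarrow> real) \<Rightarrow> ('k \<Rightarrow> real^'m::{finite,enum}^'k \<Rightarrow> real \<Rightarrow> real)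
   \<Rightarrow> real^'m::{finite,enum}^'k \<Rightarrow> real \<Rightarrow> real^'m::{finite,enum}^'k \<Rightarrow> real \<Rightarrow> real^'m::{finite,enum}^'k" where
  "gd_step g \<tau> f V h X t =
     pexp g (porigin g)
       (odot (\<lambda>i. exp (- h * (1 / \<tau> i + f i X t))) (plog g (porigin g) (gd_mid g f V h X t)))"

primrec gd_iter ::
  "('k::finite \<Rightarrow> model) \<Rightarrow> ('k \<Rightarrow> real) \<Rightarrow> ('k \<Rightarrow> real^'m::{finite,enum}^'k \<Rightarrow> real \<Rightarrow> real)
   \<Rightarrow> real^'m::{finite,enum}^'k \<Rightarrow> real \<Rightarrow> nat \<Rightarrow> real^'m::{finite,enum}^'k \<Rightarrow> nat \<Rightarrow> real^'m::{finite,enum}^'k" where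
  "gd_iter g \<tau> f V T N x0 0 = x0"
| "gd_iter g \<tau> f V T N x0 (Suc j) =
     gd_step g \<tau> f V (T / real N) (gd_iter g \<tau> f V T N x0 j) (real j * (T / real N))"

definition C1_on :: "'a::euclidean_space set \<Rightarrow> ('a \<Rightarrow> real) \<Rightarrow> bool" where
  "C1_on U h \<longleftrightarrow> (\<exists>D :: 'a \<Rightarrow> ('a \<Rightarrow>\<^sub>L real).
      (\<forall>z\<in>U. (h has_derivative blinfun_apply (D z)) (at z)) \<and> continuous_on U D)"

definition C1_on_PT :: "('k::finite \<Rightarrow> model) \<Rightarrow> real \<Rightarrow> (real^'m::{finite,enum}^'k \<Rightarrow> real \<Rightarrow> real) \<Rightarrow> bool" where
  "C1_on_PT g T h \<longleftrightarrow> (\<exists>U G. open U \<and> pcarrier g \<times> {0..T} \<subseteq> U \<and> C1_on U G \<and>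
      (\<forall>X\<in>pcarrier g. \<forall>t\<in>{0..T}. G (X, t) = h X t))"

text \<open>A subset of the product is away from the cut loci relevant for the maps used
(exp is global on all factors; log/transport based at the origin are smooth on
hyperbolic and Euclidean factors everywhere, and on a sphere factor away from the
antipode of the origin).\<close>
definition away_from_cut :: "('k::finite \<Rightarrow> model) \<Rightarrow> (real^'m::{finite,enum}^'k) set \<Rightarrow> bool" where
  "away_from_cut g \<Omega> \<longleftrightarrow>
     (\<forall>X\<in>\<Omega>. \<forall>i. (case g i of Sph R n \<Rightarrow> X $ i \<noteq> - origin (g i) | _ \<Rightarrow> True))"

end

theory Submission
  imports Defs
begin

text \<open>
Everything is measured in the ambient Euclidean norm, which dominates each geodesic distance up to
a constant. The vector field \<open>F\<close> of the ODE is Lipschitz on the compact region: the only delicate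
ingredient is the factor \<open>\<theta> / sin \<theta>\<close> (or \<open>\<theta> / sinh \<theta>\<close>) of the logarithm, which is a Lipschitz
function of \<open>cos \<theta>\<close> (or \<open>cosh \<theta>\<close>) away from the cut locus. Geodesics have bounded ambient
acceleration, and the geodesic \<open>s \<mapsto> Exp\<^sub>o (s Log\<^sub>o y)\<close> passes \<open>y\<close> at \<open>s = 1\<close> with velocity
\<open>- Log\<^sub>y o\<close>, so a GD step equals \<open>X + h F (X, t) + O(h\<^sup>2)\<close> uniformly on the region. The exact
solution has the same expansion, and a discrete Gronwall argument concludes.
\<close>

section \<open>Lipschitz functions and Taylor remainders\<close>

text \<open>The region \<open>\<Omega>\<close> is an arbitrary compact set, possibly not convex and
  not containing the geodesics between its points. Lipschitz bounds are assembled from sums,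
  products, inverses and compositions of functions on the set itself, with compactness supplying
  upper bounds and a uniform gap to the cut locus. Remainders are computed on the closed-form curves
  of \<open>rexp\<close>, whose acceleration is bounded even where they leave the region. In the
  zero-padded ambient space, points and tangent vectors at different base points can be subtracted
  directly, so scheme and solution are both compared with the ambient Euler step. That step
  generally leaves the manifold, but it serves only as an algebraic intermediary. The second half of
  a GD step produces the logarithm at the intermediate point instead of at \<open>X\<close>; since
  the first half moves by O(h) and the logarithm is multiplied by O(h), the exchange costs
  O(h^2).\<close>

lemma C1_lipschitz_on_compact:
  fixes G :: "'a::euclidean_space \<Rightarrow> real"
  assumes "C1_on U G" "open U" "compact K" "K \<subseteq> U"
  shows "\<exists>L. L-lipschitz_on K G"
proof -
  obtain D :: "'a \<Rightarrow> 'a \<Rightarrow>\<^sub>L real"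
    where D: "\<And>z. z \<in> U \<Longrightarrow> (G has_derivative blinfun_apply (D z)) (at z)"
      and cont: "continuous_on U D"
    using assms(1) unfolding C1_on_def by blast
  \<comment> \<open>\<open>K\<close> need not be convex, so a local Lipschitz property is globalised
    by compactness. The C1 criterion speaks of time-dependent vector fields: \<open>G\<close> is
    turned into a field along the unit vector \<open>e\<close> with a dummy time, and unit length
    preserves the constant.\<close>
  obtain e :: 'a where e: "e \<in> Basis" using nonempty_Basis by blast
  have "local_lipschitz (UNIV :: real set) U (\<lambda>t z. G z *\<^sub>R e)"
  proof (rule c1_implies_local_lipschitz)
    fix t :: real and z assume "z \<in> U"
    show "((\<lambda>z. G z *\<^sub>R e) has_derivative
        blinfun_apply ((\<lambda>(t, z). blinfun_scaleR_left e o\<^sub>L D z) (t, z))) (at z)"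
      using D[OF \<open>z \<in> U\<close>] by (auto intro!: derivative_eq_intros)
  next
    show "continuous_on (UNIV \<times> U) (\<lambda>(t::real, z). blinfun_scaleR_left e o\<^sub>L D z)"
      unfolding split_beta
      by (intro continuous_intros continuous_on_compose2[OF cont]) auto
  qed (use assms in auto)
  then have "local_lipschitz {0::real} K (\<lambda>t z. G z *\<^sub>R e)"
    using assms by (auto intro: local_lipschitz_subset)
  from local_lipschitz_compact_implies_lipschitz[OF this \<open>compact K\<close>]
  obtain L where L: "L-lipschitz_on K (\<lambda>z. G z *\<^sub>R e)"
    by force
  have "norm (G x *\<^sub>R e - G y *\<^sub>R e) = norm (G x - G y)" for x y
    using e by (simp flip: scaleR_left_diff_distrib)
  then have "L-lipschitz_on K G"
    using L unfolding lipschitz_on_def dist_norm by simp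
  then show ?thesis ..
qed

section \<open>Closure properties of Lipschitz functions on bounded sets\<close>

lemma lipschitz_on_bounded_image:
  fixes f :: "'a::metric_space \<Rightarrow> 'b::real_normed_vector"
  assumes "L-lipschitz_on S f" "bounded S"
  shows "\<exists>B\<ge>0. \<forall>x\<in>S. norm (f x) \<le> B"
proof (cases "S = {}")
  case False
  then obtain a where a: "a \<in> S" by blast
  obtain M where M: "\<And>y. y \<in> S \<Longrightarrow> dist a y \<le> M"
    using assms(2) a unfolding bounded_any_center[of _ a] by blast
  have "L \<ge> 0" using assms(1) by (rule lipschitz_on_nonneg)
  have "norm (f x) \<le> norm (f a) + L * M" if "x \<in> S" for x
  proof -
    have "dist (f a) (f x) \<le> L * dist a x"
      using assms(1) a that by (rule lipschitz_onD)
    also have "\<dots> \<le> L * M" using M[OF that] \<open>L \<ge> 0\<close> by (rule mult_left_mono)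
    finally show ?thesis
      using norm_triangle_ineq2[of "f x" "f a"] by (simp add: dist_norm norm_minus_commute)
  qed
  then have "\<forall>x\<in>S. norm (f x) \<le> max 0 (norm (f a) + L * M)" by fastforce
  then show ?thesis by (metis max.cobounded1)
qed auto

lemma lipschitz_on_scaleR:
  fixes a :: "'a::metric_space \<Rightarrow> real" and f :: "'a \<Rightarrow> 'b::real_normed_vector"
  assumes "\<exists>L. L-lipschitz_on S a" "\<exists>L. L-lipschitz_on S f" "bounded S"
  shows "\<exists>L. L-lipschitz_on S (\<lambda>x. a x *\<^sub>R f x)"
proof -
  obtain L M where L: "L-lipschitz_on S a" and M: "M-lipschitz_on S f"
    using assms by blast
  obtain A where A: "A \<ge> 0" "\<And>x. x \<in> S \<Longrightarrow> norm (a x) \<le> A"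
    using lipschitz_on_bounded_image[OF L assms(3)] by blast
  obtain B where B: "B \<ge> 0" "\<And>x. x \<in> S \<Longrightarrow> norm (f x) \<le> B"
    using lipschitz_on_bounded_image[OF M assms(3)] by blast
  have nn: "L \<ge> 0" "M \<ge> 0" using L M by (auto dest: lipschitz_on_nonneg)
  have "(A * M + L * B)-lipschitz_on S (\<lambda>x. a x *\<^sub>R f x)"
  proof (rule lipschitz_onI)
    fix x y assume xy: "x \<in> S" "y \<in> S"
    have "a x *\<^sub>R f x - a y *\<^sub>R f y = a x *\<^sub>R (f x - f y) + (a x - a y) *\<^sub>R f y"
      by (simp add: algebra_simps)
    then have "dist (a x *\<^sub>R f x) (a y *\<^sub>R f y)
        \<le> norm (a x) * dist (f x) (f y) + dist (a x) (a y) * norm (f y)"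
      unfolding dist_norm by (metis norm_scaleR norm_triangle_ineq real_norm_def)
    also have "\<dots> \<le> A * (M * dist x y) + (L * dist x y) * B"
      using xy A B nn lipschitz_onD[OF L xy] lipschitz_onD[OF M xy]
      by (intro add_mono mult_mono) auto
    finally show "dist (a x *\<^sub>R f x) (a y *\<^sub>R f y) \<le> (A * M + L * B) * dist x y"
      by (simp add: algebra_simps)
  qed (use A B nn in auto)
  then show ?thesis ..
qed

text \<open>Meant for the denominators of \<open>ptrans\<close>: 1/a - 1/b = (b - a)/(ab), and the
  lower bound \<open>m\<close> controls the product ab.\<close>

lemma lipschitz_on_inverse:
  fixes a :: "'a::metric_space \<Rightarrow> real"
  assumes "\<exists>L. L-lipschitz_on S a" "m > 0" "\<And>x. x \<in> S \<Longrightarrow> a x \<ge> m"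
  shows "\<exists>L. L-lipschitz_on S (\<lambda>x. inverse (a x))"
proof -
  obtain L where L: "L-lipschitz_on S a" using assms by blast
  have "L \<ge> 0" using L by (rule lipschitz_on_nonneg)
  have "(L / m\<^sup>2)-lipschitz_on S (\<lambda>x. inverse (a x))"
  proof (rule lipschitz_onI)
    fix x y assume xy: "x \<in> S" "y \<in> S"
    have pos: "a x > 0" "a y > 0" using assms(2) assms(3)[OF xy(1)] assms(3)[OF xy(2)] by linarith+
    have "dist (inverse (a x)) (inverse (a y)) = dist (a x) (a y) / (a x * a y)"
      using pos unfolding dist_real_def by (simp add: divide_simps abs_minus_commute)
    also have "\<dots> \<le> (L * dist x y) / (m * m)"
      using assms xy pos lipschitz_onD[OF L xy] \<open>L \<ge> 0\<close>
      by (intro frac_le mult_mono) auto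
    finally show "dist (inverse (a x)) (inverse (a y)) \<le> L / m\<^sup>2 * dist x y"
      by (simp add: power2_eq_square)
  qed (use \<open>L \<ge> 0\<close> in auto)
  then show ?thesis ..
qed

text \<open>Hiding the constant behind an existential quantifier lets \<open>intro\<close> follow
  the syntax of a map without tracking constants.\<close>

lemma ex_lipschitz_on_add:
  fixes f g :: "'a::metric_space \<Rightarrow> 'b::real_normed_vector"
  assumes "\<exists>L. L-lipschitz_on S f" "\<exists>L. L-lipschitz_on S g"
  shows "\<exists>L. L-lipschitz_on S (\<lambda>x. f x + g x)"
  using assms lipschitz_on_add by blast

lemma ex_lipschitz_on_diff:
  fixes f g :: "'a::metric_space \<Rightarrow> 'b::real_normed_vector"
  assumes "\<exists>L. L-lipschitz_on S f" "\<exists>L. L-lipschitz_on S g"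
  shows "\<exists>L. L-lipschitz_on S (\<lambda>x. f x - g x)"
  using assms lipschitz_on_diff by blast

lemma ex_lipschitz_on_const: "\<exists>L. L-lipschitz_on S (\<lambda>x. c)"
  using lipschitz_on_constant by blast

lemma ex_lipschitz_on_id: "\<exists>L. L-lipschitz_on S (\<lambda>x. x)"
  using lipschitz_on_id by blast

lemma ex_lipschitz_on_linear:
  fixes f :: "'a::real_normed_vector \<Rightarrow> 'b::real_normed_vector"
  assumes "bounded_linear f"
  shows "\<exists>L. L-lipschitz_on S f"
  by (meson assms bounded_linear.lipschitz_boundE)

lemma ex_lipschitz_on_compose:
  assumes "\<exists>L. L-lipschitz_on T f" "\<exists>L. L-lipschitz_on S g" "g ` S \<subseteq> T"
  shows "\<exists>L. L-lipschitz_on S (\<lambda>x. f (g x))"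
proof -
  obtain L M where L: "L-lipschitz_on T f" and M: "M-lipschitz_on S g" using assms by blast
  show ?thesis using lipschitz_on_compose2[OF M lipschitz_on_subset[OF L assms(3)]] ..
qed

lemma ex_lipschitz_on_cong:
  assumes "\<exists>L. L-lipschitz_on S g" "\<And>x. x \<in> S \<Longrightarrow> f x = g x"
  shows "\<exists>L. L-lipschitz_on S f"
  using assms by (metis lipschitz_on_transform)

lemma ex_lipschitz_on_vec:
  fixes F :: "'a::metric_space \<Rightarrow> 'b::real_normed_vector^'k"
  assumes "\<And>i. \<exists>L. L-lipschitz_on S (\<lambda>z. F z $ i)"
  shows "\<exists>L. L-lipschitz_on S F"
proof -
  obtain L where L: "\<And>i. (L i)-lipschitz_on S (\<lambda>z. F z $ i)" using assms by metis
  have "(\<Sum>i\<in>UNIV. L i)-lipschitz_on S F"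
  proof (rule lipschitz_onI)
    fix x y assume xy: "x \<in> S" "y \<in> S"
    have "dist (F x) (F y) \<le> (\<Sum>i\<in>UNIV. dist (F x $ i) (F y $ i))"
      unfolding dist_vec_def by (rule L2_set_le_sum) simp
    also have "\<dots> \<le> (\<Sum>i\<in>UNIV. L i * dist x y)"
      using L xy by (intro sum_mono) (rule lipschitz_onD)
    finally show "dist (F x) (F y) \<le> (\<Sum>i\<in>UNIV. L i) * dist x y" by (simp add: sum_distrib_right)
  qed (use L in \<open>auto intro: sum_nonneg lipschitz_on_nonneg\<close>)
  then show ?thesis ..
qed

lemmas ex_lipschitz_intros = ex_lipschitz_on_add ex_lipschitz_on_diff ex_lipschitz_on_const
  ex_lipschitz_on_id lipschitz_on_scaleR

text \<open>The mean value inequality for \<open>f\<close> minus its linearization at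
  \<open>r\<close>, whose derivative on the segment is at most \<open>L * \<bar>s - r\<bar>\<close>.
  A Lipschitz derivative is what the ODE solution offers; \<open>s < r\<close> is allowed because
  geodesics are also expanded at their far end.\<close>

lemma remainder_bound_lipschitz_derivative:
  fixes f :: "real \<Rightarrow> 'b::real_normed_vector"
  assumes der: "\<And>u. u \<in> S \<Longrightarrow> (f has_vector_derivative f' u) (at u within S)"
    and lip: "L-lipschitz_on S f'" and "closed_segment r s \<subseteq> S"
  shows "norm (f s - f r - (s - r) *\<^sub>R f' r) \<le> L * (s - r)\<^sup>2"
proof -
  let ?I = "closed_segment r s"
  have "norm (f s - f r - (s - r) *\<^sub>R f' r) \<le> norm (s - r) * (L * norm (s - r))"
  proof (rule vector_differentiable_bound_linearization[of ?I])
    show "(f has_vector_derivative f' u) (at u within ?I)" if "u \<in> ?I" for u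
      using der assms(3) that has_vector_derivative_within_subset by blast
    show "norm (f' u - f' r) \<le> L * norm (s - r)" if "u \<in> ?I" for u
    proof -
      have "norm (f' u - f' r) \<le> L * dist u r"
        using lipschitz_onD[OF lip, of u r] assms(3) that by (auto simp: dist_norm)
      also have "\<dots> \<le> L * norm (s - r)"
        using that lipschitz_on_nonneg[OF lip]
        by (intro mult_left_mono) (auto simp: dist_norm closed_segment_eq_real_ivl split: if_splits)
      finally show ?thesis .
    qed
  qed auto
  also have "\<dots> = L * (s - r)\<^sup>2"
    by (simp add: power2_eq_square abs_mult_self_eq mult.left_commute)
  finally show ?thesis .
qed

lemma remainder_bound_second_derivative:
  fixes f :: "real \<Rightarrow> 'b::real_normed_vector"
  assumes "\<And>u. u \<in> {a..b} \<Longrightarrow> (f has_vector_derivative f' u) (at u)"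
    and "\<And>u. u \<in> {a..b} \<Longrightarrow> (f' has_vector_derivative f'' u) (at u)"
    and "\<And>u. u \<in> {a..b} \<Longrightarrow> norm (f'' u) \<le> B" and "r \<in> {a..b}" "s \<in> {a..b}"
  shows "norm (f s - f r - (s - r) *\<^sub>R f' r) \<le> B * (s - r)\<^sup>2"
proof (rule remainder_bound_lipschitz_derivative[of "{a..b}"])
  show "B-lipschitz_on {a..b} f'"
  proof (rule bounded_derivative_imp_lipschitz)
    show "(f' has_derivative (\<lambda>h. h *\<^sub>R f'' u)) (at u within {a..b})" if "u \<in> {a..b}" for u
      using assms(2)[OF that] has_derivative_at_withinI
      by (auto simp: has_vector_derivative_def)
    show "onorm (\<lambda>h. h *\<^sub>R f'' u) \<le> B" if "u \<in> {a..b}" for u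
      using assms(3)[OF that]
      by (intro onorm_le) (auto simp: mult.commute[of _ "\<bar>_\<bar>"] intro!: mult_left_mono)
    show "0 \<le> B" using assms(3)[OF assms(4)] norm_ge_zero order_trans by blast
  qed auto
  show "closed_segment r s \<subseteq> {a..b}"
    using assms(4,5) by (auto simp: closed_segment_eq_real_ivl)
qed (use assms(1) in \<open>auto intro: has_vector_derivative_at_within\<close>)

text \<open>Each of the \<open>j\<close> local errors is amplified by at most
  \<open>exp (L * h * real j)\<close>. This form avoids the division by \<open>L\<close> of the
  geometric sum, so \<open>L = 0\<close> is no special case; with \<open>c\<close> of order h^2 and
  j h <= T it yields order h.\<close>

lemma discrete_gronwall:
  fixes e :: "nat \<Rightarrow> real"
  assumes "L \<ge> 0" "h \<ge> 0" "c \<ge> 0" "e 0 \<le> 0"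
    and "\<And>j. j < n \<Longrightarrow> e (Suc j) \<le> (1 + L * h) * e j + c"
  shows "j \<le> n \<Longrightarrow> e j \<le> real j * c * exp (L * h * real j)"
proof (induction j)
  case (Suc j)
  have "e (Suc j) \<le> (1 + L * h) * e j + c" using Suc by (intro assms) auto
  also have "\<dots> \<le> exp (L * h) * (real j * c * exp (L * h * real j)) + c * exp (L * h * real (Suc j))"
  proof (rule add_mono)
    have "(1 + L * h) * e j \<le> (1 + L * h) * (real j * c * exp (L * h * real j))"
      using Suc assms by (intro mult_left_mono) auto
    also have "\<dots> \<le> exp (L * h) * (real j * c * exp (L * h * real j))"
      using assms by (intro mult_right_mono) auto
    finally show "(1 + L * h) * e j \<le> exp (L * h) * (real j * c * exp (L * h * real j))" .
    show "c \<le> c * exp (L * h * real (Suc j))"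
      using assms by (simp add: mult_le_cancel_left1)
  qed
  also have "\<dots> = real (Suc j) * c * exp (L * h * real (Suc j))"
    by (simp add: algebra_simps exp_add)
  finally show ?case .
qed (use assms in auto)

section \<open>The angular factor of the logarithm\<close>

text \<open>The reciprocal of \<open>sinc\<close>, taken at the angle between two points, is the
  scalar factor of the spherical logarithm. The value 1 at 0 is the continuous extension and covers
  coinciding points.\<close>

definition sinc :: "real \<Rightarrow> real" where
  "sinc u = (if u = 0 then 1 else sin u / u)"

definition sinhc :: "real \<Rightarrow> real" where
  "sinhc u = (if u = 0 then 1 else sinh u / u)"

lemma isCont_sinc: "isCont sinc u"
proof (cases "u = 0")
  case True
  have "((\<lambda>u::real. sin u / u) \<longlongrightarrow> 1) (at 0)"
    using DERIV_sin[of "0::real"] by (simp add: DERIV_def)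
  then have "(sinc \<longlongrightarrow> 1) (at 0)"
    by (rule Lim_transform_eventually) (auto simp: eventually_at_filter sinc_def)
  with True show ?thesis by (simp add: isCont_def sinc_def)
next
  case False
  have "isCont (\<lambda>u. sin u / u) u" using False by (intro continuous_intros) auto
  moreover have ev: "\<forall>\<^sub>F v in nhds u. sinc v = sin v / v"
    using t1_space_nhds[OF False] by eventually_elim (simp add: sinc_def)
  ultimately show ?thesis using isCont_cong[OF ev] by simp
qed

lemma isCont_sinhc: "isCont sinhc u"
proof (cases "u = 0")
  case True
  have "DERIV sinh (0::real) :> cosh 0" by (auto intro!: derivative_eq_intros)
  then have "((\<lambda>u::real. sinh u / u) \<longlongrightarrow> 1) (at 0)"
    by (simp add: DERIV_def)
  then have "(sinhc \<longlongrightarrow> 1) (at 0)"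
    by (rule Lim_transform_eventually) (auto simp: eventually_at_filter sinhc_def)
  with True show ?thesis by (simp add: isCont_def sinhc_def)
next
  case False
  have "isCont (\<lambda>u. sinh u / u) u" using False by (intro continuous_intros) auto
  moreover have ev: "\<forall>\<^sub>F v in nhds u. sinhc v = sinh v / v"
    using t1_space_nhds[OF False] by eventually_elim (simp add: sinhc_def)
  ultimately show ?thesis using isCont_cong[OF ev] by simp
qed

lemma sinc_pos: "0 \<le> u \<Longrightarrow> u < pi \<Longrightarrow> sinc u > 0"
  by (auto simp: sinc_def sin_gt_zero)

lemma sinhc_pos: "sinhc u > 0"
  by (cases "u > 0") (auto simp: sinhc_def zero_less_divide_iff)

text \<open>Only the open interval is treated: Cauchy's mean value theorem asks for derivatives in
  the interior and for mere continuity at the endpoint 0, which \<open>isCont_sinc\<close>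
  provides.\<close>

lemma DERIV_inverse_sinc:
  assumes "0 < u" "u < pi"
  shows "DERIV (\<lambda>u. inverse (sinc u)) u :> (sin u - u * cos u) / (sin u)\<^sup>2"
proof -
  have s: "sin u > 0" using assms by (rule sin_gt_zero)
  have "DERIV (\<lambda>u. u / sin u) u :> (sin u - u * cos u) / (sin u)\<^sup>2"
    using s by (auto intro!: derivative_eq_intros simp: power2_eq_square)
  then show ?thesis
  proof (rule has_field_derivative_transform_within_open[where S = "{0<..}"])
    show "v / sin v = inverse (sinc v)" if "v \<in> {0<..}" for v
      using that by (simp add: sinc_def)
  qed (use assms in auto)
qed

lemma DERIV_inverse_sinhc:
  assumes "0 < u"
  shows "DERIV (\<lambda>u. inverse (sinhc u)) u :> (sinh u - u * cosh u) / (sinh u)\<^sup>2"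
proof -
  have s: "sinh u > 0" using assms by simp
  have "DERIV (\<lambda>u. u / sinh u) u :> (sinh u - u * cosh u) / (sinh u)\<^sup>2"
    using s by (auto intro!: derivative_eq_intros simp: power2_eq_square)
  then show ?thesis
  proof (rule has_field_derivative_transform_within_open[where S = "{0<..}"])
    show "v / sinh v = inverse (sinhc v)" if "v \<in> {0<..}" for v
      using that by (simp add: sinhc_def)
  qed (use assms in auto)
qed

section \<open>Elementary inequalities for sine and hyperbolic sine\<close>

lemma mult_cos_le_sin:
  assumes "0 \<le> u" "u \<le> pi"
  shows "u * cos u \<le> sin u"
proof -
  have "(\<lambda>u. sin u - u * cos u) 0 \<le> (\<lambda>u. sin u - u * cos u) u"
  proof (rule DERIV_nonneg_imp_nondecreasing[OF assms(1)])
    fix v assume v: "0 \<le> v" "v \<le> u"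
    then have "DERIV (\<lambda>u. sin u - u * cos u) v :> v * sin v"
      by (auto intro!: derivative_eq_intros)
    moreover have "v * sin v \<ge> 0" using v assms sin_ge_zero by auto
    ultimately show "\<exists>y. DERIV (\<lambda>u. sin u - u * cos u) v :> y \<and> 0 \<le> y" by blast
  qed
  then show ?thesis by simp
qed

text \<open>A weak form of Jordan's inequality. Up to pi/3 the cosine is at least 1/2, so u/2 <= u
  cos u <= sin u; beyond pi/3 the sine is at least sqrt 3 / 2 >= 2/3, while u/3 <= pi/6 <
  2/3.\<close>

lemma third_le_sin:
  assumes "0 \<le> u" "u \<le> pi / 2"
  shows "u / 3 \<le> sin u"
proof (cases "u \<le> pi / 3")
  case True
  have "cos (pi / 3) \<le> cos u" using True assms by (intro cos_monotone_0_pi_le) auto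
  then have "u * (1 / 2) \<le> u * cos u" using assms by (intro mult_left_mono) (auto simp: cos_60)
  with mult_cos_le_sin[of u] show ?thesis using assms by auto
next
  case False
  have "sin (pi / 3) \<le> sin u" using False assms by (intro sin_monotone_2pi_le) auto
  moreover have "4 / 3 \<le> sqrt (3::real)" by (rule real_le_rsqrt) (simp add: power2_eq_square)
  ultimately show ?thesis using assms pi_less_4 by (simp add: sin_60)
qed

text \<open>Comparing the increments of \<open>inverse (sinc u)\<close> and \<open>cos u\<close>
  leaves the quotient of \<open>sin u - u * cos u\<close> by the cube of \<open>sin u\<close>. Its
  numerator must vanish to third order at 0 for the quotient to stay bounded there.\<close>

lemma abs_sin_minus_mult_cos_le:
  assumes "0 \<le> u" "u \<le> pi"
  shows "\<bar>sin u - u * cos u\<bar> \<le> u ^ 3"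
proof -
  have "u * cos u \<le> sin u" using assms by (rule mult_cos_le_sin)
  moreover have "(\<lambda>u. u ^ 3 - (sin u - u * cos u)) 0 \<le> (\<lambda>u. u ^ 3 - (sin u - u * cos u)) u"
  proof (rule DERIV_nonneg_imp_nondecreasing[OF assms(1)])
    fix v assume v: "0 \<le> v" "v \<le> u"
    then have "DERIV (\<lambda>u. u ^ 3 - (sin u - u * cos u)) v :> 3 * v\<^sup>2 - v * sin v"
      by (auto intro!: derivative_eq_intros)
    moreover have "v * sin v \<le> v * v" using v sin_x_le_x by (intro mult_left_mono) auto
    then have "3 * v\<^sup>2 - v * sin v \<ge> 0"
      using zero_le_power2[of v] by (simp only: power2_eq_square)
    ultimately show "\<exists>y. DERIV (\<lambda>u. u ^ 3 - (sin u - u * cos u)) v :> y \<and> 0 \<le> y" by blast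
  qed
  ultimately show ?thesis by simp
qed

lemma le_sinh: "0 \<le> u \<Longrightarrow> u \<le> sinh u" for u :: real
  using real_le_x_sinh[of u] by (simp add: sinh_field_def exp_minus)

text \<open>The hyperbolic counterpart has to hold on an unbounded range, where the left side
  outgrows \<open>u ^ 3\<close>. The bound by \<open>u\<^sup>2 * sinh u\<close> survives
  differentiation, and u <= sinh u turns it into the cube of \<open>sinh u\<close>, which gives the
  Lipschitz constant 1 later.\<close>

lemma abs_sinh_minus_mult_cosh_le:
  fixes u :: real
  assumes "0 \<le> u"
  shows "\<bar>sinh u - u * cosh u\<bar> \<le> (sinh u) ^ 3"
proof -
  have "(\<lambda>u::real. u * cosh u - sinh u) 0 \<le> (\<lambda>u. u * cosh u - sinh u) u"
  proof (rule DERIV_nonneg_imp_nondecreasing[OF assms(1)])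
    fix v assume v: "0 \<le> v" "v \<le> u"
    then have "DERIV (\<lambda>u. u * cosh u - sinh u) v :> v * sinh v"
      by (auto intro!: derivative_eq_intros)
    moreover have "v * sinh v \<ge> 0" using v by auto
    ultimately show "\<exists>y. DERIV (\<lambda>u. u * cosh u - sinh u) v :> y \<and> 0 \<le> y" by blast
  qed
  moreover have "(\<lambda>u::real. u\<^sup>2 * sinh u - (u * cosh u - sinh u)) 0
      \<le> (\<lambda>u. u\<^sup>2 * sinh u - (u * cosh u - sinh u)) u"
  proof (rule DERIV_nonneg_imp_nondecreasing[OF assms(1)])
    fix v assume v: "0 \<le> v" "v \<le> u"
    then have "DERIV (\<lambda>u. u\<^sup>2 * sinh u - (u * cosh u - sinh u)) v :> v * sinh v + v\<^sup>2 * cosh v"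
      by (auto intro!: derivative_eq_intros simp: algebra_simps)
    moreover have "v * sinh v + v\<^sup>2 * cosh v \<ge> 0" using v by auto
    ultimately show "\<exists>y. DERIV (\<lambda>u. u\<^sup>2 * sinh u - (u * cosh u - sinh u)) v :> y \<and> 0 \<le> y"
      by blast
  qed
  moreover have "u\<^sup>2 * sinh u \<le> (sinh u)\<^sup>2 * sinh u"
    using assms le_sinh[OF assms] by (intro mult_right_mono power_mono) auto
  ultimately show ?thesis by (simp add: power3_eq_cube power2_eq_square)
qed

text \<open>Both \<open>arccos c / sqrt (1 - c\<^sup>2)\<close> and \<open>arcosh c / sqrt (c\<^sup>2 - 1)\<close> extend smoothly to \<open>c = 1\<close>.
  Cauchy's mean value theorem in the angle variable gives their Lipschitz property up to \<open>c = 1\<close>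
  without dividing by the vanishing square root.\<close>

lemma lipschitz_on_inverse_sinc_arccos:
  assumes "-1 < c0"
  shows "\<exists>L. L-lipschitz_on {c0..1} (\<lambda>c. inverse (sinc (arccos c)))"
proof (cases "c0 \<le> 1")
  case True
  define th where "th = arccos c0"
  have th: "0 \<le> th" "th < pi"
    using assms True arccos_lbound arccos_ubound[of c0] arccos_less_arccos[of "-1" c0]
    by (auto simp: th_def)
  \<comment> \<open>The minimum \<open>m\<close> of \<open>sinc\<close> on this interval is positive
    because \<open>-1 < c0\<close> keeps \<open>th\<close> below pi. It yields m w <= sin w and so
    trades w^3 for a multiple of the cube of sin w.\<close>
  have "continuous_on {0..th} sinc" using isCont_sinc continuous_at_imp_continuous_on by blast
  then obtain a where a: "a \<in> {0..th}" "\<And>u. u \<in> {0..th} \<Longrightarrow> sinc a \<le> sinc u"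
    using continuous_attains_inf[of "{0..th}" sinc] th by auto
  define m where "m = sinc a"
  have m: "m > 0" using a(1) th by (auto simp: m_def intro: sinc_pos)
  have ord: "\<bar>inverse (sinc u) - inverse (sinc v)\<bar> \<le> 1 / m ^ 3 * \<bar>cos u - cos v\<bar>"
    if uv: "0 \<le> u" "u < v" "v \<le> th" for u v
  proof -
    have "\<exists>w. u < w \<and> w < v \<and> (inverse (sinc v) - inverse (sinc u)) * (- sin w)
        = (cos v - cos u) * ((sin w - w * cos w) / (sin w)\<^sup>2)"
    proof (rule GMVT'[OF uv(2)])
      fix z assume z: "u \<le> z" "z \<le> v"
      then have "sinc z > 0" using uv th by (intro sinc_pos) auto
      then show "isCont (\<lambda>u. inverse (sinc u)) z" by (intro continuous_intros isCont_sinc) auto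
    next
      fix z assume z: "u < z" "z < v"
      then show "DERIV (\<lambda>u. inverse (sinc u)) z :> (sin z - z * cos z) / (sin z)\<^sup>2"
        using uv th by (intro DERIV_inverse_sinc) auto
    qed (auto intro!: derivative_eq_intros)
    then obtain w where w: "u < w" "w < v" and
      eq: "(inverse (sinc v) - inverse (sinc u)) * (- sin w)
        = (cos v - cos u) * ((sin w - w * cos w) / (sin w)\<^sup>2)" by blast
    have w0: "0 < w" "w < pi" using w uv th by auto
    have s: "sin w > 0" using w0 by (rule sin_gt_zero)
    have "m * w \<le> sin w"
      using a(2)[of w] w uv w0 by (simp add: m_def sinc_def pos_le_divide_eq split: if_splits)
    then have "(m * w) ^ 3 \<le> (sin w) ^ 3" using m w0 by (intro power_mono) auto
    then have "w ^ 3 \<le> (sin w) ^ 3 / m ^ 3"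
      using m by (simp add: pos_le_divide_eq power_mult_distrib mult.commute)
    with abs_sin_minus_mult_cos_le[of w] w0
    have bd: "\<bar>sin w - w * cos w\<bar> \<le> (sin w) ^ 3 / m ^ 3" by linarith
    have "\<bar>inverse (sinc v) - inverse (sinc u)\<bar> * sin w
        = \<bar>cos v - cos u\<bar> * (\<bar>sin w - w * cos w\<bar> / (sin w)\<^sup>2)"
      using arg_cong[OF eq, of abs] s by (simp add: abs_mult)
    also have "\<dots> \<le> \<bar>cos v - cos u\<bar> * (((sin w) ^ 3 / m ^ 3) / (sin w)\<^sup>2)"
      using bd by (intro mult_left_mono divide_right_mono) auto
    also have "\<dots> = (1 / m ^ 3 * \<bar>cos v - cos u\<bar>) * sin w"
      using s by (simp add: power3_eq_cube power2_eq_square)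
    finally have "\<bar>inverse (sinc v) - inverse (sinc u)\<bar> \<le> 1 / m ^ 3 * \<bar>cos v - cos u\<bar>"
      using s mult_le_cancel_right_pos by blast
    then show ?thesis by (simp add: abs_minus_commute)
  qed
  have all: "\<bar>inverse (sinc u) - inverse (sinc v)\<bar> \<le> 1 / m ^ 3 * \<bar>cos u - cos v\<bar>"
    if "u \<in> {0..th}" "v \<in> {0..th}" for u v
    using ord[of u v] ord[of v u] that
    by (cases u v rule: linorder_cases) (auto simp: abs_minus_commute)
  have "(1 / m ^ 3)-lipschitz_on {c0..1} (\<lambda>c. inverse (sinc (arccos c)))"
  proof (rule lipschitz_onI)
    fix c d assume cd: "c \<in> {c0..1}" "d \<in> {c0..1}"
    have "arccos c \<in> {0..th}" "arccos d \<in> {0..th}"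
      using cd assms by (auto simp: th_def intro!: arccos_lbound arccos_le_arccos)
    from all[OF this] show "dist (inverse (sinc (arccos c))) (inverse (sinc (arccos d)))
        \<le> 1 / m ^ 3 * dist c d"
      using cd assms by (simp add: dist_real_def)
  qed (use m in auto)
  then show ?thesis ..
qed (auto simp: lipschitz_on_def)

lemma lipschitz_on_inverse_sinhc_arcosh:
  "1-lipschitz_on {1..} (\<lambda>c. inverse (sinhc (arcosh c)))"
proof -
  have ord: "\<bar>inverse (sinhc u) - inverse (sinhc v)\<bar> \<le> \<bar>cosh u - cosh v\<bar>"
    if uv: "0 \<le> u" "u < v" for u v
  proof -
    have "\<exists>w. u < w \<and> w < v \<and> (inverse (sinhc v) - inverse (sinhc u)) * sinh w
        = (cosh v - cosh u) * ((sinh w - w * cosh w) / (sinh w)\<^sup>2)"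
    proof (rule GMVT'[OF uv(2)])
      fix z
      show "isCont (\<lambda>u. inverse (sinhc u)) z"
        using sinhc_pos[of z] by (intro continuous_intros isCont_sinhc) auto
    next
      fix z assume z: "u < z" "z < v"
      then show "DERIV (\<lambda>u. inverse (sinhc u)) z :> (sinh z - z * cosh z) / (sinh z)\<^sup>2"
        using uv by (intro DERIV_inverse_sinhc) auto
    qed (auto intro!: derivative_eq_intros isCont_cosh)
    then obtain w where w: "u < w" "w < v" and
      eq: "(inverse (sinhc v) - inverse (sinhc u)) * sinh w
        = (cosh v - cosh u) * ((sinh w - w * cosh w) / (sinh w)\<^sup>2)" by blast
    have s: "sinh w > 0" using w uv by auto
    have "\<bar>inverse (sinhc v) - inverse (sinhc u)\<bar> * sinh w
        = \<bar>cosh v - cosh u\<bar> * (\<bar>sinh w - w * cosh w\<bar> / (sinh w)\<^sup>2)"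
      using arg_cong[OF eq, of abs] s by (simp add: abs_mult)
    also have "\<dots> \<le> \<bar>cosh v - cosh u\<bar> * ((sinh w) ^ 3 / (sinh w)\<^sup>2)"
      using abs_sinh_minus_mult_cosh_le[of w] w uv by (intro mult_left_mono divide_right_mono) auto
    also have "\<dots> = \<bar>cosh v - cosh u\<bar> * sinh w"
      using s by (simp add: power3_eq_cube power2_eq_square)
    finally show ?thesis using s by (simp add: abs_minus_commute)
  qed
  have all: "\<bar>inverse (sinhc u) - inverse (sinhc v)\<bar> \<le> \<bar>cosh u - cosh v\<bar>"
    if "u \<ge> 0" "v \<ge> 0" for u v
    using ord[of u v] ord[of v u] that
    by (cases u v rule: linorder_cases) (auto simp: abs_minus_commute)
  show ?thesis
  proof (rule lipschitz_onI)
    fix c d :: real assume "c \<in> {1..}" "d \<in> {1..}"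
    then show "dist (inverse (sinhc (arcosh c))) (inverse (sinhc (arcosh d))) \<le> 1 * dist c d"
      using all[of "arcosh c" "arcosh d"] by (simp add: dist_real_def)
  qed simp
qed

section \<open>Geodesics of the model spaces\<close>

text \<open>For nonzero \<open>w\<close> and \<open>th = norm w / R\<close> this is the curve u ->
  exp_p(u w) of the sphere. Its acceleration is bounded on the whole line, and the free base point
  \<open>r\<close> serves expansions at 0 (for the first exponential of a step) and at 1 (for the
  second).\<close>

lemma trig_curve_remainder:
  fixes p w :: "'a::real_normed_vector" and th r s :: real
  defines "\<gamma> \<equiv> \<lambda>u. cos (u * th) *\<^sub>R p + (sin (u * th) / th) *\<^sub>R w"
  assumes "th > 0"
  shows "norm (\<gamma> s - \<gamma> r - (s - r) *\<^sub>R (cos (r * th) *\<^sub>R w - (th * sin (r * th)) *\<^sub>R p))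
    \<le> (th\<^sup>2 * norm p + th * norm w) * (s - r)\<^sup>2"
proof (rule remainder_bound_second_derivative[where a = "min r s" and b = "max r s"
      and f'' = "\<lambda>u. - (th\<^sup>2 * cos (u * th)) *\<^sub>R p - (th * sin (u * th)) *\<^sub>R w"
      and f' = "\<lambda>u. cos (u * th) *\<^sub>R w - (th * sin (u * th)) *\<^sub>R p"])
  fix u
  show "(\<gamma> has_vector_derivative cos (u * th) *\<^sub>R w - (th * sin (u * th)) *\<^sub>R p) (at u)"
    unfolding \<gamma>_def using assms(2)
    by (auto intro!: derivative_eq_intros simp: has_vector_derivative_def algebra_simps
        simp flip: scaleR_scaleR)
  show "((\<lambda>u. cos (u * th) *\<^sub>R w - (th * sin (u * th)) *\<^sub>R p) has_vector_derivative
      - (th\<^sup>2 * cos (u * th)) *\<^sub>R p - (th * sin (u * th)) *\<^sub>R w) (at u)"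
    by (auto intro!: derivative_eq_intros simp: has_vector_derivative_def algebra_simps power2_eq_square)
  have "norm (- (th\<^sup>2 * cos (u * th)) *\<^sub>R p - (th * sin (u * th)) *\<^sub>R w)
      \<le> norm (- (th\<^sup>2 * cos (u * th)) *\<^sub>R p) + norm ((th * sin (u * th)) *\<^sub>R w)"
    by (rule norm_triangle_ineq4)
  also have "\<dots> = th\<^sup>2 * \<bar>cos (u * th)\<bar> * norm p + th * \<bar>sin (u * th)\<bar> * norm w"
    using assms(2) by (simp add: abs_mult)
  also have "\<dots> \<le> th\<^sup>2 * 1 * norm p + th * 1 * norm w"
    using assms(2) by (intro add_mono mult_mono) auto
  finally show "norm (- (th\<^sup>2 * cos (u * th)) *\<^sub>R p - (th * sin (u * th)) *\<^sub>R w)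
      \<le> th\<^sup>2 * norm p + th * norm w" by simp
qed auto

text \<open>The hyperbolic functions are unbounded, so the parameters stay in the unit interval and
  \<open>cosh th\<close> enters the constant; it dominates both \<open>cosh (u * th)\<close> and
  \<open>sinh (u * th)\<close> there.\<close>

lemma hyp_curve_remainder:
  fixes p w :: "'a::real_normed_vector" and th r s :: real
  defines "\<gamma> \<equiv> \<lambda>u. cosh (u * th) *\<^sub>R p + (sinh (u * th) / th) *\<^sub>R w"
  assumes "th > 0" "r \<in> {0..1}" "s \<in> {0..1}"
  shows "norm (\<gamma> s - \<gamma> r - (s - r) *\<^sub>R (cosh (r * th) *\<^sub>R w + (th * sinh (r * th)) *\<^sub>R p))
    \<le> (th\<^sup>2 * norm p + th * norm w) * cosh th * (s - r)\<^sup>2"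
proof (rule remainder_bound_second_derivative[where a = 0 and b = 1
      and f'' = "\<lambda>u. (th\<^sup>2 * cosh (u * th)) *\<^sub>R p + (th * sinh (u * th)) *\<^sub>R w"
      and f' = "\<lambda>u. cosh (u * th) *\<^sub>R w + (th * sinh (u * th)) *\<^sub>R p"])
  fix u :: real assume u: "u \<in> {0..1}"
  show "(\<gamma> has_vector_derivative cosh (u * th) *\<^sub>R w + (th * sinh (u * th)) *\<^sub>R p) (at u)"
    unfolding \<gamma>_def using assms(2)
    by (auto intro!: derivative_eq_intros simp: has_vector_derivative_def algebra_simps
        simp flip: scaleR_scaleR)
  show "((\<lambda>u. cosh (u * th) *\<^sub>R w + (th * sinh (u * th)) *\<^sub>R p) has_vector_derivative
      (th\<^sup>2 * cosh (u * th)) *\<^sub>R p + (th * sinh (u * th)) *\<^sub>R w) (at u)"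
    by (auto intro!: derivative_eq_intros simp: has_vector_derivative_def algebra_simps power2_eq_square)
  have "u * th \<le> 1 * th" using u assms by (intro mult_right_mono) auto
  then have c: "cosh (u * th) \<le> cosh th"
    using u assms by (subst cosh_real_nonneg_le_iff) auto
  have sh: "0 \<le> sinh (u * th)" using u assms by simp
  have sc: "sinh (u * th) \<le> cosh th" using c sinh_le_cosh_real order_trans by blast
  have "norm ((th\<^sup>2 * cosh (u * th)) *\<^sub>R p + (th * sinh (u * th)) *\<^sub>R w)
      \<le> norm ((th\<^sup>2 * cosh (u * th)) *\<^sub>R p) + norm ((th * sinh (u * th)) *\<^sub>R w)"
    by (rule norm_triangle_ineq)
  also have "\<dots> = th\<^sup>2 * cosh (u * th) * norm p + th * sinh (u * th) * norm w"
    using assms(2) sh by (simp add: abs_mult)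
  also have "\<dots> \<le> th\<^sup>2 * cosh th * norm p + th * cosh th * norm w"
    using assms(2) c sc sh by (intro add_mono mult_mono) auto
  finally show "norm ((th\<^sup>2 * cosh (u * th)) *\<^sub>R p + (th * sinh (u * th)) *\<^sub>R w)
      \<le> (th\<^sup>2 * norm p + th * norm w) * cosh th" by (simp add: algebra_simps)
qed (use assms in auto)

section \<open>Sphere factors: exponential, logarithm, chord and arc\<close>

lemma rexp_Sph_scaleR:
  assumes "R > 0" "w \<noteq> 0" "s \<ge> 0"
  shows "rexp (Sph R n) p (s *\<^sub>R w)
    = cos (s * (norm w / R)) *\<^sub>R p + (sin (s * (norm w / R)) / (norm w / R)) *\<^sub>R w"
  using assms by (auto simp: Let_def)

text \<open>With c the cosine of the angle, the squared norms of x - y and x + y are 2 R^2 (1 - c)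
  and 2 R^2 (1 + c). Nonnegativity gives both bounds, and they are strict unless the points coincide
  or are antipodal.\<close>

lemma Sph_cos_bounds:
  fixes x y :: "'a::real_inner"
  assumes "R > 0" "norm x = R" "norm y = R"
  shows "-1 \<le> (x \<bullet> y) / R\<^sup>2" "(x \<bullet> y) / R\<^sup>2 \<le> 1"
    and "y \<noteq> - x \<Longrightarrow> -1 < (x \<bullet> y) / R\<^sup>2" "y \<noteq> x \<Longrightarrow> (x \<bullet> y) / R\<^sup>2 < 1"
    and "(norm (x - y))\<^sup>2 = 2 * R\<^sup>2 * (1 - (x \<bullet> y) / R\<^sup>2)"
    and "(norm (y - ((x \<bullet> y) / R\<^sup>2) *\<^sub>R x))\<^sup>2 = R\<^sup>2 * (1 - ((x \<bullet> y) / R\<^sup>2)\<^sup>2)"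
proof -
  have xx: "x \<bullet> x = R\<^sup>2" "y \<bullet> y = R\<^sup>2" using assms by (simp_all add: dot_square_norm)
  have R2: "R\<^sup>2 > 0" using assms by simp
  show dm: "(norm (x - y))\<^sup>2 = 2 * R\<^sup>2 * (1 - (x \<bullet> y) / R\<^sup>2)"
    unfolding power2_norm_eq_inner using R2 by (simp add: algebra_simps inner_commute xx)
  have dp: "(norm (x + y))\<^sup>2 = 2 * R\<^sup>2 * (1 + (x \<bullet> y) / R\<^sup>2)"
    unfolding power2_norm_eq_inner using R2 by (simp add: algebra_simps inner_commute xx)
  show "(x \<bullet> y) / R\<^sup>2 \<le> 1" using dm R2 zero_le_power2[of "norm (x - y)"]
    by (simp add: zero_le_mult_iff)
  show "-1 \<le> (x \<bullet> y) / R\<^sup>2" using dp R2 zero_le_power2[of "norm (x + y)"]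
    by (simp add: zero_le_mult_iff)
  show "(x \<bullet> y) / R\<^sup>2 < 1" if "y \<noteq> x"
  proof -
    have "(norm (x - y))\<^sup>2 > 0" using that by simp
    with dm R2 show ?thesis by (simp add: zero_less_mult_iff)
  qed
  show "-1 < (x \<bullet> y) / R\<^sup>2" if "y \<noteq> - x"
  proof -
    have "(norm (x + y))\<^sup>2 > 0" using that by (simp add: add_eq_0_iff)
    with dp R2 show ?thesis by (simp add: zero_less_mult_iff)
  qed
  show "(norm (y - ((x \<bullet> y) / R\<^sup>2) *\<^sub>R x))\<^sup>2 = R\<^sup>2 * (1 - ((x \<bullet> y) / R\<^sup>2)\<^sup>2)"
    unfolding power2_norm_eq_inner using R2
    by (simp add: algebra_simps inner_commute xx power2_eq_square)
qed

text \<open>At angle th the vector on the right has norm R sin th and the distance is R th, so the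
  scalar factor is th / sin th. Writing it through \<open>sinc\<close> absorbs the case y = x, so
  one formula serves the whole region.\<close>

lemma rlog_Sph_eq:
  assumes "R > 0" "norm x = R" "norm y = R" "y \<noteq> - x"
  shows "rlog (Sph R n) x y
    = inverse (sinc (arccos ((x \<bullet> y) / R\<^sup>2))) *\<^sub>R (y - ((x \<bullet> y) / R\<^sup>2) *\<^sub>R x)"
proof -
  define c where "c = (x \<bullet> y) / R\<^sup>2"
  define u where "u = y - c *\<^sub>R x"
  have nu: "(norm u)\<^sup>2 = R\<^sup>2 * (1 - c\<^sup>2)"
    unfolding u_def c_def using assms(1-3) by (rule Sph_cos_bounds)
  show ?thesis
  proof (cases "y = x")
    case True
    then have "(x \<bullet> x) / R\<^sup>2 = 1" using assms by (simp add: dot_square_norm)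
    then show ?thesis using True by (simp add: Let_def)
  next
    case False
    have c: "-1 < c" "c < 1" using Sph_cos_bounds(3,4)[OF assms(1-3)] assms(4) False by (auto simp: c_def)
    have "c\<^sup>2 < 1" using c by (simp add: abs_square_less_1 abs_less_iff)
    then have s: "sqrt (1 - c\<^sup>2) > 0" by simp
    have "norm u = sqrt (R\<^sup>2 * (1 - c\<^sup>2))" using nu by (metis norm_ge_zero real_sqrt_unique)
    then have n: "norm u = R * sqrt (1 - c\<^sup>2)" using assms by (simp add: real_sqrt_mult)
    then have "u \<noteq> 0" using s assms by auto
    moreover have "arccos c \<noteq> 0" using c by (simp add: arccos_eq_0_iff)
    ultimately show ?thesis
      using n s assms c by (simp add: Let_def sinc_def sin_arccos flip: c_def u_def)
  qed
qed

text \<open>The chord has length 2 R sin (th/2) and the arc R th; \<open>third_le_sin\<close> at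
  th/2 makes the chord at least a third of the arc.\<close>

lemma gdist_Sph_le:
  assumes "R > 0" "norm x = R" "norm y = R"
  shows "gdist (Sph R n) x y \<le> 3 * norm (x - y)"
proof -
  define c where "c = (x \<bullet> y) / R\<^sup>2"
  define th where "th = arccos c"
  have c: "-1 \<le> c" "c \<le> 1" using Sph_cos_bounds(1,2)[OF assms] by (auto simp: c_def)
  have th: "0 \<le> th" "th \<le> pi" using c by (auto simp: th_def intro: arccos_lbound arccos_ubound)
  have "cos (2 * (th / 2)) = 1 - 2 * (sin (th / 2))\<^sup>2" by (rule cos_double_sin)
  then have "1 - c = 2 * (sin (th / 2))\<^sup>2" using c by (simp add: th_def)
  then have "(norm (x - y))\<^sup>2 = (2 * R * sin (th / 2))\<^sup>2"
    using Sph_cos_bounds(5)[OF assms] by (simp add: power_mult_distrib flip: c_def)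
  moreover have "sin (th / 2) \<ge> 0" using th by (intro sin_ge_zero) auto
  ultimately have "norm (x - y) = 2 * R * sin (th / 2)"
    using assms(1) by (simp add: power2_eq_iff_nonneg)
  moreover have "th / 2 / 3 \<le> sin (th / 2)" using th by (intro third_le_sin) auto
  then have "R * (th / 2 / 3) \<le> R * sin (th / 2)" using assms(1) by (intro mult_left_mono) auto
  ultimately show ?thesis by (simp flip: c_def th_def)
qed

lemma rexp_Sph_remainder:
  assumes "R > 0"
  shows "norm (rexp (Sph R n) x w - x - w) \<le> (norm x / R\<^sup>2 + 1 / R) * (norm w)\<^sup>2"
proof (cases "w = 0")
  case False
  have "norm (rexp (Sph R n) x w - x - w)
      \<le> ((norm w / R)\<^sup>2 * norm x + (norm w / R) * norm w) * 1"
    using trig_curve_remainder[of "norm w / R" 1 x w 0] rexp_Sph_scaleR[OF assms False, of 1 n x]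
      assms False by simp
  then show ?thesis by (simp add: algebra_simps power2_eq_square)
qed simp

text \<open>The geodesic from \<open>p\<close> to \<open>y\<close> is expanded at its end point,
  parameter 1. Since |p| = R and |w| = R th, the acceleration bound is 2 th^2 R, and th <= pi
  removes the dependence on \<open>y\<close>.\<close>

lemma rexp_rlog_Sph_remainder:
  assumes "R > 0" "norm p = R" "norm y = R" "y \<noteq> - p" "s \<ge> 0"
  shows "norm (rexp (Sph R n) p (s *\<^sub>R rlog (Sph R n) p y) - y - (1 - s) *\<^sub>R rlog (Sph R n) y p)
    \<le> 2 * pi\<^sup>2 * R * (1 - s)\<^sup>2"
proof (cases "y = p")
  case True
  then show ?thesis using assms by (simp add: Let_def dot_square_norm)
next
  case False
  define c where "c = (p \<bullet> y) / R\<^sup>2"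
  define th where "th = arccos c"
  define u where "u = y - c *\<^sub>R p"
  define w where "w = rlog (Sph R n) p y"
  have c: "-1 < c" "c < 1" using Sph_cos_bounds(3,4)[OF assms(1-3)] assms(4) False by (auto simp: c_def)
  have th: "0 < th" "th < pi" using arccos_lt_bounded[OF c] by (auto simp: th_def)
  have sth: "sin th > 0" using th by (rule sin_gt_zero)
  have cth: "cos th = c" using c by (simp add: th_def)
  have w: "w = (th / sin th) *\<^sub>R u"
    using rlog_Sph_eq[OF assms(1-4)] th by (simp add: w_def u_def sinc_def flip: c_def th_def)
  have l: "rlog (Sph R n) y p = (th / sin th) *\<^sub>R (p - c *\<^sub>R y)"
    using rlog_Sph_eq[OF assms(1,3,2)] assms(4) th
    by (simp add: sinc_def inner_commute[of y p] minus_equation_iff[of y] eq_commute[of p] flip: c_def th_def)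
  have "(norm u)\<^sup>2 = R\<^sup>2 * (1 - c\<^sup>2)"
    unfolding u_def c_def using assms(1-3) by (rule Sph_cos_bounds)
  also have "\<dots> = (R * sin th)\<^sup>2" using sin_squared_eq[of th] cth by (simp add: power_mult_distrib)
  finally have "norm u = R * sin th" using assms(1) sth by (simp add: power2_eq_iff_nonneg)
  then have nw: "norm w = R * th" using w th sth by simp
  then have w0: "w \<noteq> 0" using assms th by auto
  have g1: "cos (1 * th) *\<^sub>R p + (sin (1 * th) / th) *\<^sub>R w = y"
    using th sth by (simp add: w cth u_def)
  \<comment> \<open>The end velocity: with u = y - c p and c^2 + sin^2 th = 1, the bracket collapses
    to c y - p, the negative of the direction from \<open>y\<close> to \<open>p\<close>.\<close>
  have "cos th *\<^sub>R w - (th * sin th) *\<^sub>R p = (th / sin th) *\<^sub>R (c *\<^sub>R u - (sin th)\<^sup>2 *\<^sub>R p)"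
    using sth by (simp add: w cth algebra_simps power2_eq_square)
  also have "c *\<^sub>R u - (sin th)\<^sup>2 *\<^sub>R p = - (p - c *\<^sub>R y)"
    unfolding u_def sin_squared_eq cth by (simp add: algebra_simps power2_eq_square)
  finally have v1: "cos (1 * th) *\<^sub>R w - (th * sin (1 * th)) *\<^sub>R p = - rlog (Sph R n) y p"
    unfolding l by (simp only: mult_1 scaleR_minus_right)
  have gs: "rexp (Sph R n) p (s *\<^sub>R w) = cos (s * th) *\<^sub>R p + (sin (s * th) / th) *\<^sub>R w"
    using rexp_Sph_scaleR[OF assms(1) w0 assms(5), of n p] nw assms(1) by simp
  have "norm (rexp (Sph R n) p (s *\<^sub>R w) - y - (s - 1) *\<^sub>R (- rlog (Sph R n) y p))
      \<le> (th\<^sup>2 * norm p + th * norm w) * (s - 1)\<^sup>2"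
    using trig_curve_remainder[OF th(1), of s p w 1] unfolding g1 v1 gs .
  also have "\<dots> = 2 * th\<^sup>2 * R * (1 - s)\<^sup>2"
    using assms by (simp add: nw power2_eq_square algebra_simps)
  also have "\<dots> \<le> 2 * pi\<^sup>2 * R * (1 - s)\<^sup>2"
    using th assms(1) by (intro mult_right_mono mult_left_mono power_mono) auto
  finally show ?thesis by (simp add: w_def algebra_simps)
qed

section \<open>The Lorentz form on the ambient space and the hyperboloid\<close>

lemma linner_commute: "linner x y = linner y x"
  by (simp add: linner_def inner_commute)

lemma linner_add_left: "linner (x + y) z = linner x z + linner y z"
  by (simp add: linner_def algebra_simps)

lemma linner_scaleR_left: "linner (a *\<^sub>R x) y = a * linner x y"
  by (simp add: linner_def algebra_simps)

lemma linner_diff_left: "linner (x - y) z = linner x z - linner y z"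
  by (simp add: linner_def algebra_simps)

lemma linner_add_right: "linner z (x + y) = linner z x + linner z y"
  by (simp add: linner_def algebra_simps)

lemma linner_scaleR_right: "linner y (a *\<^sub>R x) = a * linner y x"
  by (simp add: linner_def algebra_simps)

lemma linner_diff_right: "linner z (x - y) = linner z x - linner z y"
  by (simp add: linner_def algebra_simps)

lemma linner_zero [simp]: "linner 0 y = 0" "linner y 0 = 0"
  by (simp_all add: linner_def)

lemmas linner_simps = linner_add_left linner_scaleR_left linner_diff_left
  linner_add_right linner_scaleR_right linner_diff_right

lemma bounded_linear_linner_left: "bounded_linear (\<lambda>x. linner x y)"
  unfolding linner_def
  by (intro bounded_linear_sub bounded_linear_inner_left bounded_linear_mult_const
      bounded_linear_const_mult bounded_linear_vec_nth)

lemma linner_self_le: "linner x x \<le> (norm x)\<^sup>2"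
  by (simp add: linner_def power2_norm_eq_inner)

lemma abs_linner_le: "\<bar>linner x y\<bar> \<le> 3 * norm x * norm y"
proof -
  have "\<bar>linner x y\<bar> \<le> \<bar>x \<bullet> y\<bar> + 2 * (\<bar>x $ cidx 0\<bar> * \<bar>y $ cidx 0\<bar>)"
    unfolding linner_def by (simp add: abs_mult[symmetric] mult.assoc)
  also have "\<dots> \<le> norm x * norm y + 2 * (norm x * norm y)"
    by (intro add_mono mult_left_mono mult_mono Cauchy_Schwarz_ineq2 component_le_norm_cart) auto
  finally show ?thesis by simp
qed

text \<open>The upper sheet in the full ambient space. It contains \<open>carrier (Hyp K n)\<close>
  for every \<open>n\<close>, which makes the estimates independent of the zero padding.\<close>

definition hyperboloid :: "real \<Rightarrow> (real^'m::{finite,enum}) set" where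
  "hyperboloid K = {x. linner x x = - K \<and> x $ cidx 0 > 0}"

lemma linner_eq_norm: "x $ cidx 0 = 0 \<Longrightarrow> linner x x = (norm x)\<^sup>2"
  by (simp add: linner_def power2_norm_eq_inner)

text \<open>Reversed Cauchy--Schwarz: the combination \<open>y\<^sub>0 x - x\<^sub>0 y\<close> is spacelike.\<close>

lemma hyperboloid_linner:
  assumes "K > 0" "x \<in> hyperboloid K" "y \<in> hyperboloid K"
  shows "- linner x y / K \<ge> 1" and "y \<noteq> x \<Longrightarrow> - linner x y / K > 1"
proof -
  define a b where "a = x $ cidx 0" and "b = y $ cidx 0"
  define d where "d = b *\<^sub>R x - a *\<^sub>R y"
  have ab: "a > 0" "b > 0" and xx: "linner x x = - K" "linner y y = - K"
    using assms by (auto simp: a_def b_def hyperboloid_def)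
  have "d $ cidx 0 = 0" by (simp add: d_def a_def b_def)
  then have d: "linner d d = (norm d)\<^sup>2" by (rule linner_eq_norm)
  have dd: "linner d d = 2 * a * b * (- linner x y) - K * (a\<^sup>2 + b\<^sup>2)"
    using linner_commute[of y x] xx by (simp add: d_def linner_simps algebra_simps power2_eq_square)
  \<comment> \<open>Completing the square in \<open>a\<close> and \<open>b\<close>. The right side
    vanishes only if a = b and d = 0, that is, if x = y, which also settles the strict
    inequality.\<close>
  have split: "2 * a * b * (- linner x y - K) = (norm d)\<^sup>2 + K * (a - b)\<^sup>2"
    using d dd by (simp add: algebra_simps power2_eq_square)
  have ab2: "2 * a * b > 0" using ab by simp
  have "2 * a * b * (- linner x y - K) \<ge> 0"
    unfolding split using assms(1) by simp
  then have "- linner x y - K \<ge> 0" using ab2 unfolding zero_le_mult_iff[of "2 * a * b"] by linarith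
  then show "- linner x y / K \<ge> 1" using assms(1) by (simp add: field_simps)
  show "- linner x y / K > 1" if "y \<noteq> x"
  proof -
    have "(norm d)\<^sup>2 + K * (a - b)\<^sup>2 > 0"
    proof (cases "a = b")
      case True
      then have "d \<noteq> 0" using that ab by (auto simp: d_def simp flip: scaleR_diff_right)
      then show ?thesis using assms(1) by (intro add_pos_nonneg) auto
    next
      case False
      then show ?thesis using assms(1) by (intro add_nonneg_pos) auto
    qed
    then have "- linner x y - K > 0" using ab2 unfolding split[symmetric] by (rule zero_less_mult_pos)
    then show ?thesis using assms(1) by (simp add: field_simps)
  qed
qed

text \<open>Subtracting the multiple b x that cancels the time component leaves a spatial vector d.
  By orthogonality to x the mixed terms vanish, so the form at v is |d|^2 + K b^2. This makes the
  square root in \<open>rexp\<close> genuine.\<close>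

lemma linner_tangent_pos:
  assumes "K > 0" "x \<in> hyperboloid K" "linner x v = 0" "v \<noteq> 0"
  shows "linner v v > 0"
proof -
  define b where "b = v $ cidx 0 / x $ cidx 0"
  define d where "d = v - b *\<^sub>R x"
  have x: "x $ cidx 0 > 0" "linner x x = - K" using assms by (auto simp: hyperboloid_def)
  have "d $ cidx 0 = 0" using x by (simp add: d_def b_def)
  then have "linner d d = (norm d)\<^sup>2" by (rule linner_eq_norm)
  moreover have "linner d d = linner v v - K * b\<^sup>2"
    using assms(3) linner_commute[of v x] x by (simp add: d_def linner_simps power2_eq_square)
  ultimately have eq: "linner v v = (norm d)\<^sup>2 + K * b\<^sup>2" by simp
  show ?thesis
  proof (cases "b = 0")
    case True
    then have "d = v" by (simp add: d_def)
    then show ?thesis using eq True assms by simp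
  next
    case False
    then show ?thesis unfolding eq using assms by (intro add_nonneg_pos) auto
  qed
qed

section \<open>Hyperbolic factors: exponential, logarithm and distance\<close>

lemma rexp_Hyp_scaleR:
  assumes "K > 0" "linner w w > 0" "s \<ge> 0"
  defines "th \<equiv> sqrt (linner w w) / sqrt K"
  shows "rexp (Hyp K n) p (s *\<^sub>R w) = cosh (s * th) *\<^sub>R p + (sinh (s * th) / th) *\<^sub>R w"
proof (cases "s = 0")
  case False
  have "sqrt (linner (s *\<^sub>R w) (s *\<^sub>R w)) = s * sqrt (linner w w)"
    using assms(3) by (simp add: linner_simps real_sqrt_mult flip: mult.assoc)
  then show ?thesis using assms False by (simp add: Let_def)
qed (simp add: linner_simps)

lemma linner_hyperboloid_log:
  assumes "K > 0" "x \<in> hyperboloid K" "y \<in> hyperboloid K"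
  defines "c \<equiv> - linner x y / K"
  shows "linner (y - c *\<^sub>R x) (y - c *\<^sub>R x) = K * (c\<^sup>2 - 1)"
proof -
  have "linner x y = - K * c" "linner y x = - K * c" "linner x x = - K" "linner y y = - K"
    using assms linner_commute[of y x] by (auto simp: c_def hyperboloid_def)
  then show ?thesis by (simp add: linner_simps algebra_simps power2_eq_square)
qed

text \<open>With c = cosh th the Lorentz length of the vector on the right is sqrt K sinh th and the
  distance is sqrt K th. Passing to \<open>sinhc\<close> again absorbs y = x.\<close>

lemma rlog_Hyp_eq:
  assumes "K > 0" "x \<in> hyperboloid K" "y \<in> hyperboloid K"
  shows "rlog (Hyp K n) x y
    = inverse (sinhc (arcosh (- linner x y / K))) *\<^sub>R (y - (- linner x y / K) *\<^sub>R x)"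
proof (cases "y = x")
  case True
  then show ?thesis using assms by (simp add: hyperboloid_def)
next
  case False
  define c where "c = - linner x y / K"
  define u where "u = y - c *\<^sub>R x"
  have c: "c > 1" using hyperboloid_linner[OF assms] False by (simp add: c_def)
  have "linner u u = K * (c\<^sup>2 - 1)"
    unfolding u_def c_def using assms by (rule linner_hyperboloid_log)
  then have su: "sqrt (linner u u) = sqrt K * sqrt (c\<^sup>2 - 1)" by (simp add: real_sqrt_mult)
  have "arcosh c \<noteq> 0" using c by simp
  moreover have "y + (linner x y / K) *\<^sub>R x = u" by (simp add: u_def c_def)
  moreover have "rlog (Hyp K n) x y = (sqrt K * arcosh c / sqrt (linner u u)) *\<^sub>R u"
    using False by (simp add: Let_def u_def c_def)
  ultimately show ?thesis
    unfolding c_def[symmetric] u_def[symmetric] using c assms(1) su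
    by (simp add: sinhc_def sinh_arcosh_real)
qed

lemma half_square_le_cosh: "1 + u\<^sup>2 / 2 \<le> cosh u" if "0 \<le> u" for u :: real
proof -
  have "cosh (2 * (u / 2)) = 1 + 2 * (sinh (u / 2))\<^sup>2"
    unfolding cosh_double by (simp add: cosh_square_eq)
  moreover have "(u / 2)\<^sup>2 \<le> (sinh (u / 2))\<^sup>2" using le_sinh[of "u / 2"] that by (intro power_mono) auto
  ultimately show ?thesis by (simp add: power_divide)
qed

text \<open>The Lorentz square of x - y is 2 K (cosh th - 1) >= K th^2, and the Lorentz square never
  exceeds the Euclidean one.\<close>

lemma gdist_Hyp_le:
  assumes "K > 0" "x \<in> hyperboloid K" "y \<in> hyperboloid K"
  shows "gdist (Hyp K n) x y \<le> norm (x - y)"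
proof -
  define c where "c = - linner x y / K"
  define th where "th = arcosh c"
  have c: "c \<ge> 1" using hyperboloid_linner(1)[OF assms] by (simp add: c_def)
  have th: "th \<ge> 0" "cosh th = c" using c by (auto simp: th_def)
  have "linner x y = - K * c" "linner y x = - K * c" "linner x x = - K" "linner y y = - K"
    using assms linner_commute[of y x] by (auto simp: c_def hyperboloid_def)
  then have "linner (x - y) (x - y) = K * (2 * (c - 1))"
    by (simp add: linner_simps algebra_simps)
  moreover have "K * th\<^sup>2 \<le> K * (2 * (c - 1))"
    using half_square_le_cosh[OF th(1)] th(2) assms(1) by (intro mult_left_mono) auto
  ultimately have "K * th\<^sup>2 \<le> (norm (x - y))\<^sup>2" using linner_self_le[of "x - y"] by linarith
  then have "(sqrt K * th)\<^sup>2 \<le> (norm (x - y))\<^sup>2" using assms(1) by (simp add: power_mult_distrib)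
  then show ?thesis
    unfolding gdist.simps c_def[symmetric] th_def[symmetric] by (rule power2_le_imp_le) simp
qed

lemma rexp_Hyp_remainder:
  assumes "K > 0" "x \<in> hyperboloid K" "linner x w = 0" "norm w \<le> B"
  shows "norm (rexp (Hyp K n) x w - x - w)
    \<le> (norm x / K + 1 / sqrt K) * cosh (B / sqrt K) * (norm w)\<^sup>2"
proof (cases "w = 0")
  case True
  then show ?thesis by (simp add: linner_def)
next
  case False
  define th where "th = sqrt (linner w w) / sqrt K"
  have w: "linner w w > 0" using linner_tangent_pos[OF assms(1-3) False] .
  have th: "th > 0" using w assms by (simp add: th_def)
  have thw: "th \<le> norm w / sqrt K"
    unfolding th_def using linner_self_le[of w] assms(1)
    by (intro divide_right_mono) (auto intro: real_le_lsqrt)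
  have "rexp (Hyp K n) x w = cosh (1 * th) *\<^sub>R x + (sinh (1 * th) / th) *\<^sub>R w"
    using rexp_Hyp_scaleR[OF assms(1) w, of 1 n x] by (simp add: th_def)
  then have "norm (rexp (Hyp K n) x w - x - w) \<le> (th\<^sup>2 * norm x + th * norm w) * cosh th"
    using hyp_curve_remainder[OF th, of 0 1 x w] by simp
  also have "\<dots> \<le> ((norm w / sqrt K)\<^sup>2 * norm x + (norm w / sqrt K) * norm w) * cosh (B / sqrt K)"
  proof (intro mult_mono add_mono power_mono)
    have "th \<le> B / sqrt K" using thw divide_right_mono[OF assms(4), of "sqrt K"] assms(1) by simp
    then show "cosh th \<le> cosh (B / sqrt K)"
      using th by (subst cosh_real_nonneg_le_iff) auto
  qed (use thw th assms(1) in auto)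
  also have "\<dots> = (norm x / K + 1 / sqrt K) * cosh (B / sqrt K) * (norm w)\<^sup>2"
    using assms(1) by (simp add: algebra_simps power2_eq_square)
  finally show ?thesis .
qed

text \<open>Again an expansion at the end point of the geodesic. The bound \<open>M\<close> on cosh
  th controls everything else: th <= sinh th <= cosh th <= M, and th / sinh th <= 1 gives |w| <= |y
  - c p| <= |y| + M |p|.\<close>

lemma rexp_rlog_Hyp_remainder:
  assumes "K > 0" "p \<in> hyperboloid K" "y \<in> hyperboloid K" "s \<in> {0..1}" "- linner p y / K \<le> M"
  shows "norm (rexp (Hyp K n) p (s *\<^sub>R rlog (Hyp K n) p y) - y - (1 - s) *\<^sub>R rlog (Hyp K n) y p)
    \<le> (M\<^sup>2 * norm p + M * (norm y + M * norm p)) * M * (1 - s)\<^sup>2"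
proof -
  define c where "c = - linner p y / K"
  have c1: "c \<ge> 1" using hyperboloid_linner[OF assms(1-3)] by (simp add: c_def)
  then have M: "M \<ge> 1" "c \<le> M" using assms(5) by (auto simp: c_def)
  show ?thesis
  proof (cases "y = p")
    case True
    moreover have "0 \<le> (M\<^sup>2 * norm p + M * (norm p + M * norm p)) * M * (1 - s)\<^sup>2"
      using M by auto
    ultimately show ?thesis by (simp add: linner_def)
  next
    case False
    define th where "th = arcosh c"
    define u where "u = y - c *\<^sub>R p"
    define w where "w = rlog (Hyp K n) p y"
    have c: "c > 1" using hyperboloid_linner(2)[OF assms(1-3) False] by (simp add: c_def)
    have th: "0 < th" and cth: "cosh th = c" using c by (auto simp: th_def)
    have sth: "sinh th > 0" using th by simp
    have w: "w = (th / sinh th) *\<^sub>R u"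
      unfolding w_def rlog_Hyp_eq[OF assms(1-3)] c_def[symmetric] th_def[symmetric] u_def[symmetric]
      using th by (simp add: sinhc_def)
    have c': "- linner y p / K = c" by (simp add: c_def linner_commute)
    have l: "rlog (Hyp K n) y p = (th / sinh th) *\<^sub>R (p - c *\<^sub>R y)"
      unfolding rlog_Hyp_eq[OF assms(1,3,2)] c' using th by (simp add: sinhc_def flip: th_def)
    have "linner u u = K * (c\<^sup>2 - 1)"
      unfolding u_def c_def using assms(1-3) by (rule linner_hyperboloid_log)
    then have uu: "linner u u = K * (sinh th)\<^sup>2" by (simp add: sinh_square_eq cth)
    have ww: "linner w w = K * th\<^sup>2"
      using sth by (simp add: w linner_simps uu power2_eq_square)
    then have wpos: "linner w w > 0" using assms(1) th by simp
    have thw: "sqrt (linner w w) / sqrt K = th"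
      using assms(1) th by (simp add: ww real_sqrt_mult)
    have g1: "cosh (1 * th) *\<^sub>R p + (sinh (1 * th) / th) *\<^sub>R w = y"
      using th sth by (simp add: w cth u_def)
    have "cosh th *\<^sub>R w + (th * sinh th) *\<^sub>R p = (th / sinh th) *\<^sub>R (c *\<^sub>R u + (sinh th)\<^sup>2 *\<^sub>R p)"
      using sth by (simp add: w cth algebra_simps power2_eq_square)
    also have "c *\<^sub>R u + (sinh th)\<^sup>2 *\<^sub>R p = - (p - c *\<^sub>R y)"
      unfolding u_def sinh_square_eq cth by (simp add: algebra_simps power2_eq_square)
    finally have v1: "cosh (1 * th) *\<^sub>R w + (th * sinh (1 * th)) *\<^sub>R p = - rlog (Hyp K n) y p"
      unfolding l by (simp only: mult_1 scaleR_minus_right)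
    have gs: "rexp (Hyp K n) p (s *\<^sub>R w) = cosh (s * th) *\<^sub>R p + (sinh (s * th) / th) *\<^sub>R w"
      using rexp_Hyp_scaleR[OF assms(1) wpos, of s n p] assms(4) by (simp add: thw)
    have "norm (rexp (Hyp K n) p (s *\<^sub>R w) - y - (s - 1) *\<^sub>R (- rlog (Hyp K n) y p))
        \<le> (th\<^sup>2 * norm p + th * norm w) * cosh th * (s - 1)\<^sup>2"
      using hyp_curve_remainder[OF th(1), of 1 s p w] assms(4) unfolding g1 v1 gs by simp
    also have "\<dots> \<le> (M\<^sup>2 * norm p + M * (norm y + M * norm p)) * M * (s - 1)\<^sup>2"
    proof -
      have thM: "th \<le> M"
        using le_sinh[of th] th sinh_le_cosh_real[of th] cth M by linarith
      have "norm w = th / sinh th * norm u" using w th sth by simp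
      also have "\<dots> \<le> 1 * norm u" using le_sinh[of th] th sth by (intro mult_right_mono) auto
      also have "norm u \<le> norm y + norm (c *\<^sub>R p)" unfolding u_def by (rule norm_triangle_ineq4)
      also have "norm (c *\<^sub>R p) \<le> M * norm p" using M c by (simp add: mult_right_mono)
      finally have "norm w \<le> norm y + M * norm p" by simp
      then show ?thesis
        using thM M th cth by (intro mult_right_mono mult_mono add_mono power_mono) auto
    qed
    finally show ?thesis by (simp add: w_def algebra_simps power2_eq_square)
  qed
qed

section \<open>Uniform estimates on compact regions\<close>

text \<open>What the hypotheses on the compact region give for its projection to a single factor;
  every estimate up to the local error of a step is made there.\<close>

definition regular_region :: "model \<Rightarrow> (real^'m::{finite,enum}) set \<Rightarrow> bool" where
  "regular_region M S \<longleftrightarrow> valid_model M CARD('m) \<and> compact S \<and> S \<subseteq> carrier M \<and>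
     (\<forall>x\<in>S. case M of Sph R n \<Rightarrow> x \<noteq> - origin M | _ \<Rightarrow> True)"

lemma origin_Sph: "origin (Sph R n) = axis (cidx 0) R"
  by (simp add: axis_def)

lemma norm_origin_Sph: "R > 0 \<Longrightarrow> norm (origin (Sph R n)) = R"
  by (simp only: origin_Sph norm_eq_sqrt_inner inner_axis_axis) simp

lemma origin_Hyp: "origin (Hyp K n) = axis (cidx 0) (sqrt K)"
  by (simp add: axis_def)

lemma origin_Hyp_in_hyperboloid: "K > 0 \<Longrightarrow> origin (Hyp K n) \<in> hyperboloid K"
  by (simp only: origin_Hyp hyperboloid_def) (simp add: linner_def inner_axis)

lemma regular_region_Hyp:
  assumes "regular_region (Hyp K n) S"
  shows "K > 0" "compact S" "\<And>x. x \<in> S \<Longrightarrow> x \<in> hyperboloid K"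
  using assms by (auto simp: regular_region_def hyperboloid_def)

lemma regular_region_Sph:
  assumes "regular_region (Sph R n) S"
  shows "R > 0" "compact S" "\<And>x. x \<in> S \<Longrightarrow> norm x = R" "\<And>x. x \<in> S \<Longrightarrow> x \<noteq> - origin (Sph R n)"
  using assms by (auto simp: regular_region_def)

text \<open>Compactness turns the pointwise avoidance of the antipode into a uniform gap. The gap
  keeps the angle away from pi in the logarithm and the denominator of the transport away from
  0.\<close>

lemma regular_region_Sph_cos_bound:
  assumes "regular_region (Sph R n) S"
  shows "\<exists>c0>-1. \<forall>x\<in>S. c0 \<le> (x \<bullet> origin (Sph R n)) / R\<^sup>2"
proof (cases "S = {}")
  case False
  note S = regular_region_Sph[OF assms]
  have "continuous_on S (\<lambda>x. (x \<bullet> origin (Sph R n)) / R\<^sup>2)"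
    using S(1) by (intro continuous_intros) auto
  then obtain a where a: "a \<in> S"
    "\<And>x. x \<in> S \<Longrightarrow> (a \<bullet> origin (Sph R n)) / R\<^sup>2 \<le> (x \<bullet> origin (Sph R n)) / R\<^sup>2"
    using continuous_attains_inf[OF S(2) False] by blast
  have "-1 < (a \<bullet> origin (Sph R n)) / R\<^sup>2"
  proof (rule Sph_cos_bounds(3)[OF S(1) S(3)[OF a(1)] norm_origin_Sph[OF S(1)]])
    show "origin (Sph R n) \<noteq> - a" using S(4)[OF a(1)] by (metis minus_minus)
  qed
  with a show ?thesis by blast
qed (auto intro: exI[of _ 0])

text \<open>The cosine (or hyperbolic cosine) \<open>c\<close> of the angle to the origin is linear
  in \<open>x\<close>, so the logarithm is a Lipschitz function of \<open>c\<close> times the vector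
  p - c x, which is Lipschitz on bounded sets.\<close>

lemma lipschitz_rlog_origin:
  fixes S :: "(real^'m::{finite,enum}) set"
  assumes "regular_region M S"
  shows "\<exists>L. L-lipschitz_on S (\<lambda>x. rlog M x (origin M))"
proof (cases M)
  case (Hyp K n)
  define p where "p = (origin M :: real^'m::{finite,enum})"
  define c where "c x = - linner x p / K" for x
  note S = regular_region_Hyp[OF assms[unfolded Hyp]]
  have p: "p \<in> hyperboloid K" using S(1) by (simp only: p_def Hyp origin_Hyp_in_hyperboloid)
  have "bounded_linear c"
    unfolding c_def divide_inverse
    by (intro bounded_linear_mult_const bounded_linear_minus bounded_linear_linner_left)
  then have c: "\<exists>L. L-lipschitz_on S c" by (rule ex_lipschitz_on_linear)
  have "\<exists>L. L-lipschitz_on {1..} (\<lambda>c. inverse (sinhc (arcosh c)))"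
    using lipschitz_on_inverse_sinhc_arcosh by (rule exI)
  moreover have "c ` S \<subseteq> {1..}" using hyperboloid_linner(1)[OF S(1) S(3) p] by (auto simp: c_def)
  ultimately have "\<exists>L. L-lipschitz_on S (\<lambda>x. inverse (sinhc (arcosh (c x))))"
    by (rule ex_lipschitz_on_compose[OF _ c])
  then have "\<exists>L. L-lipschitz_on S (\<lambda>x. inverse (sinhc (arcosh (c x))) *\<^sub>R (p - c x *\<^sub>R x))"
    using c S(2) by (intro ex_lipschitz_intros compact_imp_bounded)
  then show ?thesis
  proof (rule ex_lipschitz_on_cong)
    fix x assume "x \<in> S"
    then show "rlog M x (origin M) = inverse (sinhc (arcosh (c x))) *\<^sub>R (p - c x *\<^sub>R x)"
      unfolding p_def[symmetric] unfolding Hyp c_def using S p by (intro rlog_Hyp_eq)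
  qed
next
  case (Sph R n)
  define p where "p = (origin M :: real^'m::{finite,enum})"
  define c where "c x = (x \<bullet> p) / R\<^sup>2" for x
  note S = regular_region_Sph[OF assms[unfolded Sph]]
  have p: "norm p = R" using norm_origin_Sph[OF S(1)] by (simp only: p_def Sph)
  obtain c0 where c0: "c0 > -1" "\<And>x. x \<in> S \<Longrightarrow> c0 \<le> c x"
    using regular_region_Sph_cos_bound[OF assms[unfolded Sph]]
    unfolding Sph[symmetric] p_def[symmetric] c_def by blast
  have "bounded_linear c"
    unfolding c_def divide_inverse
    by (intro bounded_linear_mult_const bounded_linear_inner_left)
  then have c: "\<exists>L. L-lipschitz_on S c" by (rule ex_lipschitz_on_linear)
  have "c ` S \<subseteq> {c0..1}" using Sph_cos_bounds(2)[OF S(1) S(3) p] c0 by (auto simp: c_def)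
  then have "\<exists>L. L-lipschitz_on S (\<lambda>x. inverse (sinc (arccos (c x))))"
    by (rule ex_lipschitz_on_compose[OF lipschitz_on_inverse_sinc_arccos[OF c0(1)] c])
  then have "\<exists>L. L-lipschitz_on S (\<lambda>x. inverse (sinc (arccos (c x))) *\<^sub>R (p - c x *\<^sub>R x))"
    using c S(2) by (intro ex_lipschitz_intros compact_imp_bounded)
  then show ?thesis
  proof (rule ex_lipschitz_on_cong)
    fix x assume x: "x \<in> S"
    then have "p \<noteq> - x" using S(4)[OF x] unfolding Sph[symmetric] p_def[symmetric] by auto
    with x show "rlog M x (origin M) = inverse (sinc (arccos (c x))) *\<^sub>R (p - c x *\<^sub>R x)"
      unfolding p_def[symmetric] unfolding Sph c_def using S(1) S(3) p by (intro rlog_Sph_eq)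
  qed
next
  case (Euc n)
  have "\<exists>L. L-lipschitz_on S (\<lambda>x. 0 - x)" by (intro ex_lipschitz_intros)
  then show ?thesis using Euc by simp
qed

text \<open>Rational in \<open>x\<close>, with denominators bounded below: by \<open>K\<close>
  through the reversed Cauchy-Schwarz inequality, and by \<open>R\<^sup>2 * (1 + c0)\<close> through
  the gap to the antipode.\<close>

lemma lipschitz_ptrans_origin:
  fixes S :: "(real^'m::{finite,enum}) set"
  assumes "regular_region M S"
  shows "\<exists>L. L-lipschitz_on S (\<lambda>x. ptrans M (origin M) x V)"
proof (cases M)
  case (Hyp K n)
  define p where "p = (origin M :: real^'m::{finite,enum})"
  note S = regular_region_Hyp[OF assms[unfolded Hyp]]
  have p: "p \<in> hyperboloid K" using S(1) by (simp only: p_def Hyp origin_Hyp_in_hyperboloid)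
  have "K \<le> K - linner x p" if "x \<in> S" for x
    using hyperboloid_linner(1)[OF S(1) S(3)[OF that] p] S(1) by (simp add: field_simps)
  then have "\<exists>L. L-lipschitz_on S (\<lambda>x. inverse (K - linner x p))"
    using S(1) by (intro lipschitz_on_inverse[of _ _ K] ex_lipschitz_intros
        ex_lipschitz_on_linear bounded_linear_linner_left) auto
  then have "\<exists>L. L-lipschitz_on S
      (\<lambda>x. V + linner x V *\<^sub>R inverse (K - linner x p) *\<^sub>R (p + x))"
    using S(2) ex_lipschitz_on_linear[OF bounded_linear_linner_left[of V], of S]
    by (intro ex_lipschitz_intros compact_imp_bounded)
  then show ?thesis
  proof (rule ex_lipschitz_on_cong)
    show "ptrans M (origin M) x V = V + linner x V *\<^sub>R inverse (K - linner x p) *\<^sub>R (p + x)" for x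
      unfolding p_def[symmetric] unfolding Hyp
      by (simp add: divide_inverse linner_commute[of p x])
  qed
next
  case (Sph R n)
  define p where "p = (origin M :: real^'m::{finite,enum})"
  note S = regular_region_Sph[OF assms[unfolded Sph]]
  obtain c0 where c0: "c0 > -1" "\<And>x. x \<in> S \<Longrightarrow> c0 \<le> (x \<bullet> p) / R\<^sup>2"
    using regular_region_Sph_cos_bound[OF assms[unfolded Sph]]
    unfolding Sph[symmetric] p_def[symmetric] by blast
  have "R\<^sup>2 * (1 + c0) \<le> R\<^sup>2 + x \<bullet> p" if "x \<in> S" for x
    using c0(2)[OF that] S(1) by (simp add: field_simps)
  then have "\<exists>L. L-lipschitz_on S (\<lambda>x. inverse (R\<^sup>2 + x \<bullet> p))"
    using S(1) c0 by (intro lipschitz_on_inverse[of _ _ "R\<^sup>2 * (1 + c0)"] ex_lipschitz_intros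
        ex_lipschitz_on_linear bounded_linear_inner_left) auto
  then have "\<exists>L. L-lipschitz_on S
      (\<lambda>x. V - (x \<bullet> V) *\<^sub>R inverse (R\<^sup>2 + x \<bullet> p) *\<^sub>R (p + x))"
    using S(2) ex_lipschitz_on_linear[OF bounded_linear_inner_left[of V], of S]
    by (intro ex_lipschitz_intros compact_imp_bounded)
  then show ?thesis
  proof (rule ex_lipschitz_on_cong)
    show "ptrans M (origin M) x V = V - (x \<bullet> V) *\<^sub>R inverse (R\<^sup>2 + x \<bullet> p) *\<^sub>R (p + x)" for x
      unfolding p_def[symmetric] unfolding Sph
      by (simp add: divide_inverse inner_commute[of p x])
  qed
next
  case (Euc n)
  then show ?thesis by (simp add: ex_lipschitz_on_const)
qed

lemma rexp_rlog_remainder: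
  fixes S :: "(real^'m::{finite,enum}) set"
  assumes "regular_region M S"
  shows "\<exists>C\<ge>0. \<forall>y\<in>S. \<forall>s\<in>{0..1}.
    norm (rexp M (origin M) (s *\<^sub>R rlog M (origin M) y) - y - (1 - s) *\<^sub>R rlog M y (origin M))
      \<le> C * (1 - s)\<^sup>2"
proof (cases M)
  case (Hyp K n)
  define p where "p = (origin M :: real^'m::{finite,enum})"
  note S = regular_region_Hyp[OF assms[unfolded Hyp]]
  have p: "p \<in> hyperboloid K" using S(1) by (simp only: p_def Hyp origin_Hyp_in_hyperboloid)
  obtain B where B: "B > 0" "\<And>y. y \<in> S \<Longrightarrow> norm y \<le> B"
    using compact_imp_bounded[OF S(2)] by (auto simp: bounded_pos)
  \<comment> \<open>\<open>abs_linner_le\<close> makes \<open>M0\<close> a bound for the hyperbolic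
    cosine of the scaled distance from the origin, uniformly over \<open>S\<close>.\<close>
  define M0 where "M0 = 3 * norm p * B / K"
  have M0: "M0 \<ge> 0" using B S(1) by (simp add: M0_def)
  define C where "C = (M0\<^sup>2 * norm p + M0 * (B + M0 * norm p)) * M0"
  have "norm (rexp M p (s *\<^sub>R rlog M p y) - y - (1 - s) *\<^sub>R rlog M y p) \<le> C * (1 - s)\<^sup>2"
    if ys: "y \<in> S" "s \<in> {0..1}" for y s
  proof -
    have "- linner p y \<le> 3 * norm p * norm y" using abs_linner_le[of p y] by linarith
    also have "\<dots> \<le> 3 * norm p * B" using B(2)[OF ys(1)] by (intro mult_left_mono) auto
    finally have "- linner p y / K \<le> M0"
      unfolding M0_def using S(1) by (intro divide_right_mono) auto
    then have "norm (rexp M p (s *\<^sub>R rlog M p y) - y - (1 - s) *\<^sub>R rlog M y p)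
        \<le> (M0\<^sup>2 * norm p + M0 * (norm y + M0 * norm p)) * M0 * (1 - s)\<^sup>2"
      unfolding Hyp using S ys p by (intro rexp_rlog_Hyp_remainder)
    also have "\<dots> \<le> C * (1 - s)\<^sup>2"
      unfolding C_def using M0 B(2)[OF ys(1)]
      by (intro mult_right_mono add_mono mult_left_mono) auto
    finally show ?thesis .
  qed
  moreover have "C \<ge> 0" using M0 B by (simp add: C_def)
  ultimately show ?thesis unfolding p_def by blast
next
  case (Sph R n)
  note S = regular_region_Sph[OF assms[unfolded Sph]]
  have "2 * pi\<^sup>2 * R \<ge> 0" using S(1) by simp
  moreover have "norm (rexp M (origin M) (s *\<^sub>R rlog M (origin M) y) - y
      - (1 - s) *\<^sub>R rlog M y (origin M)) \<le> 2 * pi\<^sup>2 * R * (1 - s)\<^sup>2"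
    if "y \<in> S" "s \<in> {0..1}" for y s
    unfolding Sph using S(3,4)[OF that(1)] that(2)
    by (intro rexp_rlog_Sph_remainder[OF S(1)] norm_origin_Sph[OF S(1)]) auto
  ultimately show ?thesis by blast
next
  case (Euc n)
  then show ?thesis by (intro exI[of _ 0]) (auto simp: algebra_simps)
qed

lemma rexp_remainder:
  assumes "regular_region M S"
  shows "\<exists>C\<ge>0. \<forall>x\<in>S. \<forall>w\<in>tangent M x. norm w \<le> B \<longrightarrow>
    norm (rexp M x w - x - w) \<le> C * (norm w)\<^sup>2"
proof -
  have "compact S" using assms by (simp add: regular_region_def)
  then obtain A where A: "A > 0" "\<And>y. y \<in> S \<Longrightarrow> norm y \<le> A"
    using compact_imp_bounded[of S] by (auto simp: bounded_pos)
  show ?thesis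
  proof (cases M)
    case (Hyp K n)
    note S = regular_region_Hyp[OF assms[unfolded Hyp]]
    define C where "C = (A / K + 1 / sqrt K) * cosh (B / sqrt K)"
    have "norm (rexp M x w - x - w) \<le> C * (norm w)\<^sup>2"
      if xw: "x \<in> S" "w \<in> tangent M x" "norm w \<le> B" for x w
    proof -
      have "norm (rexp M x w - x - w) \<le> (norm x / K + 1 / sqrt K) * cosh (B / sqrt K) * (norm w)\<^sup>2"
        unfolding Hyp using S xw by (intro rexp_Hyp_remainder) (auto simp: Hyp)
      also have "\<dots> \<le> C * (norm w)\<^sup>2"
        unfolding C_def using A(2)[OF xw(1)] S(1)
        by (intro mult_right_mono add_mono divide_right_mono) auto
      finally show ?thesis .
    qed
    moreover have "C \<ge> 0" using A S(1) by (simp add: C_def)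
    ultimately show ?thesis by blast
  next
    case (Sph R n)
    note S = regular_region_Sph[OF assms[unfolded Sph]]
    have "norm (rexp M x w - x - w) \<le> (R / R\<^sup>2 + 1 / R) * (norm w)\<^sup>2" if "x \<in> S" for x w
      unfolding Sph using rexp_Sph_remainder[OF S(1), of n x w] S(3)[OF that] by (simp only:)
    moreover have "R / R\<^sup>2 + 1 / R \<ge> 0" using S(1) by simp
    ultimately show ?thesis by blast
  next
    case (Euc n)
    then show ?thesis by (intro exI[of _ 0]) auto
  qed
qed

text \<open>Tangency is what makes the hyperbolic increment spacelike in
  \<open>rexp_remainder\<close>. Pairing p + x with x gives, up to sign, exactly the denominator of
  \<open>ptrans\<close>, so the correction term cancels the normal component of V at x.\<close>

lemma ptrans_tangent:
  fixes S :: "(real^'m::{finite,enum}) set"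
  assumes "regular_region M S" "x \<in> S" "V \<in> tangent M (origin M)"
  shows "a *\<^sub>R ptrans M (origin M) x V \<in> tangent M x"
proof (cases M)
  case (Hyp K n)
  define p where "p = (origin M :: real^'m::{finite,enum})"
  note S = regular_region_Hyp[OF assms(1)[unfolded Hyp]]
  have amb: "ambient M = {x :: real^'m::{finite,enum}. \<forall>c. c \<notin> cidx ` {..<n + 1} \<longrightarrow> x $ c = 0}"
    by (simp add: Hyp ambient_def)
  have p: "p \<in> hyperboloid K" using S(1) by (simp only: p_def Hyp origin_Hyp_in_hyperboloid)
  have "p \<in> ambient M" unfolding amb unfolding p_def Hyp by auto
  moreover have "x \<in> ambient M" "V \<in> ambient M"
    using assms by (auto simp: regular_region_def Hyp)
  ultimately have "a *\<^sub>R (V + (linner x V / (K - linner p x)) *\<^sub>R (p + x)) \<in> ambient M"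
    unfolding amb by simp
  moreover have "linner x (V + (linner x V / (K - linner p x)) *\<^sub>R (p + x)) = 0"
  proof -
    define D where "D = K - linner p x"
    have "D > 0"
      unfolding D_def using hyperboloid_linner(1)[OF S(1) p S(3)[OF assms(2)]] S(1) by (simp add: field_simps)
    moreover have "linner x (p + x) = - D"
      using S(3)[OF assms(2)] by (simp add: D_def hyperboloid_def linner_simps linner_commute[of p x])
    ultimately show ?thesis by (simp add: linner_add_right linner_scaleR_right flip: D_def)
  qed
  ultimately show ?thesis
    unfolding p_def[symmetric] unfolding Hyp by (simp add: linner_simps)
next
  case (Sph R n)
  define p where "p = (origin M :: real^'m::{finite,enum})"
  note S = regular_region_Sph[OF assms(1)[unfolded Sph]]
  have amb: "ambient M = {x :: real^'m::{finite,enum}. \<forall>c. c \<notin> cidx ` {..<n + 1} \<longrightarrow> x $ c = 0}"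
    by (simp add: Sph ambient_def)
  have "p \<in> ambient M" unfolding amb unfolding p_def Sph by auto
  moreover have "x \<in> ambient M" "V \<in> ambient M"
    using assms by (auto simp: regular_region_def Sph)
  ultimately have "a *\<^sub>R (V - ((x \<bullet> V) / (R\<^sup>2 + p \<bullet> x)) *\<^sub>R (p + x)) \<in> ambient M"
    unfolding amb by simp
  moreover have "x \<bullet> (V - ((x \<bullet> V) / (R\<^sup>2 + p \<bullet> x)) *\<^sub>R (p + x)) = 0"
  proof -
    have "-1 < (p \<bullet> x) / R\<^sup>2"
      using S(4)[OF assms(2)] unfolding p_def Sph
      by (intro Sph_cos_bounds(3)[OF S(1)] norm_origin_Sph[OF S(1)] S(3)[OF assms(2)])
    then have "R\<^sup>2 + p \<bullet> x > 0" using S(1) by (simp add: field_simps)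
    moreover have "x \<bullet> p + x \<bullet> x = R\<^sup>2 + p \<bullet> x"
      using S(3)[OF assms(2)] by (simp add: inner_commute dot_square_norm)
    ultimately show ?thesis by (simp add: inner_diff_right inner_add_right)
  qed
  ultimately show ?thesis
    unfolding p_def[symmetric] unfolding Sph by simp
next
  case (Euc n)
  then show ?thesis using assms by (simp add: ambient_def)
qed

lemma gdist_le:
  fixes x y :: "real^'m::{finite,enum}"
  assumes "valid_model M CARD('m)" "x \<in> carrier M" "y \<in> carrier M"
  shows "gdist M x y \<le> 3 * norm (x - y)"
proof (cases M)
  case (Hyp K n)
  then have "x \<in> hyperboloid K" "y \<in> hyperboloid K" "K > 0" using assms by (auto simp: hyperboloid_def)
  then have "gdist M x y \<le> norm (x - y)" unfolding Hyp by (intro gdist_Hyp_le)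
  also have "\<dots> \<le> 3 * norm (x - y)" by simp
  finally show ?thesis .
next
  case (Sph R n)
  then show ?thesis using assms unfolding Sph by (intro gdist_Sph_le) auto
qed simp

section \<open>Local error of one GD step\<close>

lemma one_minus_exp_bounds:
  fixes u :: real
  assumes "0 \<le> u"
  shows "0 \<le> 1 - exp (- u)" "1 - exp (- u) \<le> u" "\<bar>1 - exp (- u) - u\<bar> \<le> u\<^sup>2"
proof -
  show "0 \<le> 1 - exp (- u)" using assms by simp
  show le: "1 - exp (- u) \<le> u" using exp_ge_add_one_self[of "- u"] by simp
  have "exp (- u) \<le> 1 / (1 + u)"
    using exp_ge_add_one_self[of u] assms by (simp add: exp_minus field_simps)
  \<comment> \<open>Because (1 + u)(1 - u + u^2) = 1 + u^3 >= 1.\<close>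
  also have "\<dots> \<le> 1 - u + u\<^sup>2" using assms by (simp add: field_simps power2_eq_square)
  finally show "\<bar>1 - exp (- u) - u\<bar> \<le> u\<^sup>2" using le by simp
qed

text \<open>Here \<open>b\<close> stands for 1 / tau and \<open>a\<close> for the value of f. The
  factors interact only through that value, so an estimate uniform in \<open>a\<close> can be proved
  factor by factor without mentioning f.\<close>

lemma gd_step_factor_remainder:
  assumes reg: "regular_region M S" and V: "V \<in> tangent M (origin M)" and "b \<ge> 0" "T \<ge> 0"
  shows "\<exists>C\<ge>0. \<forall>x\<in>S. \<forall>h\<in>{0..T}. \<forall>a\<in>{0..1}.
    rexp M x (h *\<^sub>R a *\<^sub>R ptrans M (origin M) x V) \<in> S \<longrightarrow>
    norm (rexp M (origin M) (exp (- h * (b + a)) *\<^sub>R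
        rlog M (origin M) (rexp M x (h *\<^sub>R a *\<^sub>R ptrans M (origin M) x V)))
      - x - h *\<^sub>R ((b + a) *\<^sub>R rlog M x (origin M) + a *\<^sub>R ptrans M (origin M) x V)) \<le> C * h\<^sup>2"
proof -
  let ?p = "origin M"
  let ?l = "\<lambda>x. rlog M x ?p" and ?P = "\<lambda>x. ptrans M ?p x V"
  have bd: "bounded S" using reg by (simp add: regular_region_def compact_imp_bounded)
  obtain L where L: "L-lipschitz_on S ?l" using lipschitz_rlog_origin[OF reg] by blast
  obtain Bl where Bl: "Bl \<ge> 0" "\<And>x. x \<in> S \<Longrightarrow> norm (?l x) \<le> Bl"
    using lipschitz_on_bounded_image[OF L bd] by blast
  obtain L' where "L'-lipschitz_on S ?P" using lipschitz_ptrans_origin[OF reg] by blast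
  then obtain Bp where Bp: "Bp \<ge> 0" "\<And>x. x \<in> S \<Longrightarrow> norm (?P x) \<le> Bp"
    using lipschitz_on_bounded_image bd by blast
  obtain C3 where C3: "C3 \<ge> 0" "\<And>y s. y \<in> S \<Longrightarrow> s \<in> {0..1} \<Longrightarrow>
      norm (rexp M ?p (s *\<^sub>R rlog M ?p y) - y - (1 - s) *\<^sub>R ?l y) \<le> C3 * (1 - s)\<^sup>2"
    using rexp_rlog_remainder[OF reg] by blast
  obtain C4 where C4: "C4 \<ge> 0" "\<And>x w. x \<in> S \<Longrightarrow> w \<in> tangent M x \<Longrightarrow> norm w \<le> T * Bp \<Longrightarrow>
      norm (rexp M x w - x - w) \<le> C4 * (norm w)\<^sup>2"
    using rexp_remainder[OF reg, of "T * Bp"] by blast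
  have L0: "L \<ge> 0" using L by (rule lipschitz_on_nonneg)
  define q where "q = b + 1"
  \<comment> \<open>One summand per term of the splitting at the end: the second exponential, the
    first exponential, the replacement of 1 - e by u, and the shift of the logarithm from y to x.
    \<open>q\<close> bounds b + a.\<close>
  define C where "C = C3 * q\<^sup>2 + C4 * Bp\<^sup>2 + q\<^sup>2 * Bl + q * (L * (Bp + T * (C4 * Bp\<^sup>2)))"
  have q: "q \<ge> 0" using assms by (simp add: q_def)
  have "C \<ge> 0" unfolding C_def using C3 C4 Bl Bp L0 q assms(4) by simp
  moreover have "norm (rexp M ?p (exp (- h * (b + a)) *\<^sub>R rlog M ?p (rexp M x (h *\<^sub>R a *\<^sub>R ?P x)))
      - x - h *\<^sub>R ((b + a) *\<^sub>R ?l x + a *\<^sub>R ?P x)) \<le> C * h\<^sup>2"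
    if x: "x \<in> S" and h: "h \<in> {0..T}" and a: "a \<in> {0..1}" and y: "rexp M x (h *\<^sub>R a *\<^sub>R ?P x) \<in> S"
    for x h a
  proof -
    define w where "w = h *\<^sub>R a *\<^sub>R ?P x"
    define y where "y = rexp M x w"
    define u where "u = h * (b + a)"
    define e where "e = exp (- u)"
    define z where "z = rexp M ?p (e *\<^sub>R rlog M ?p y)"
    have yS: "y \<in> S" using y by (simp add: y_def w_def)
    have u: "0 \<le> u" "u \<le> h * q" using h a assms(3) by (auto simp: u_def q_def intro!: mult_left_mono)
    have u2: "u\<^sup>2 \<le> (h * q)\<^sup>2" using u by (intro power_mono) auto
    note e = one_minus_exp_bounds[OF u(1), folded e_def]
    have "norm w = h * (a * norm (?P x))" using h a by (simp add: w_def)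
    also have "\<dots> \<le> h * (1 * Bp)" using h a Bp x by (intro mult_left_mono mult_mono) auto
    finally have w: "norm w \<le> h * Bp" by simp
    also have "h * Bp \<le> T * Bp" using h Bp by (intro mult_right_mono) auto
    finally have wT: "norm w \<le> T * Bp" .
    have "w \<in> tangent M x"
      unfolding w_def scaleR_scaleR using reg x V by (rule ptrans_tangent)
    then have "norm (y - x - w) \<le> C4 * (norm w)\<^sup>2" unfolding y_def using x wT by (intro C4)
    also have "\<dots> \<le> C4 * (h * Bp)\<^sup>2" using w C4 by (intro mult_left_mono power_mono) auto
    finally have r1: "norm (y - x - w) \<le> C4 * Bp\<^sup>2 * h\<^sup>2" by (simp add: power_mult_distrib mult_ac)
    have "norm (z - y - (1 - e) *\<^sub>R ?l y) \<le> C3 * (1 - e)\<^sup>2"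
      unfolding z_def using yS e by (intro C3) (auto simp: e_def)
    also have "\<dots> \<le> C3 * (h * q)\<^sup>2"
      using e u C3 by (intro mult_left_mono power_mono) auto
    finally have r2: "norm (z - y - (1 - e) *\<^sub>R ?l y) \<le> C3 * q\<^sup>2 * h\<^sup>2"
      by (simp add: power_mult_distrib mult_ac)
    have "norm ((1 - e - u) *\<^sub>R ?l y) \<le> (h * q)\<^sup>2 * Bl"
      unfolding norm_scaleR using e(3) u2 Bl(2)[OF yS] by (intro mult_mono) auto
    then have r3: "norm ((1 - e - u) *\<^sub>R ?l y) \<le> q\<^sup>2 * Bl * h\<^sup>2"
      by (simp add: power_mult_distrib mult_ac)
    have "norm (y - x) \<le> norm (y - x - w) + norm w" using norm_triangle_ineq[of "y - x - w" w] by simp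
    also have "\<dots> \<le> C4 * Bp\<^sup>2 * (h * T) + h * Bp"
    proof (rule add_mono)
      \<comment> \<open>One power of h is traded for T, so that the displacement y - x is bounded by
        a multiple of h.\<close>
      have "h * h \<le> h * T" using h by (intro mult_left_mono) auto
      then have "C4 * Bp\<^sup>2 * h\<^sup>2 \<le> C4 * Bp\<^sup>2 * (h * T)"
        unfolding power2_eq_square[of h] by (rule mult_left_mono) (use C4(1) in simp)
      with r1 show "norm (y - x - w) \<le> C4 * Bp\<^sup>2 * (h * T)" by (rule order_trans)
    qed (rule w)
    finally have yx: "norm (y - x) \<le> h * (Bp + T * (C4 * Bp\<^sup>2))" by (simp add: algebra_simps)
    have "norm (?l y - ?l x) \<le> L * norm (y - x)"
      using lipschitz_on_normD[OF L yS x] .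
    also have "\<dots> \<le> L * (h * (Bp + T * (C4 * Bp\<^sup>2)))" using yx L0 by (rule mult_left_mono)
    finally have "norm (u *\<^sub>R (?l y - ?l x)) \<le> (h * q) * (L * (h * (Bp + T * (C4 * Bp\<^sup>2))))"
      unfolding norm_scaleR using u by (intro mult_mono) auto
    then have r4: "norm (u *\<^sub>R (?l y - ?l x)) \<le> q * (L * (Bp + T * (C4 * Bp\<^sup>2))) * h\<^sup>2"
      by (simp add: power2_eq_square mult_ac)
    have "z - x - h *\<^sub>R ((b + a) *\<^sub>R ?l x + a *\<^sub>R ?P x)
      = (z - y - (1 - e) *\<^sub>R ?l y) + (y - x - w) + (1 - e - u) *\<^sub>R ?l y + u *\<^sub>R (?l y - ?l x)"
      unfolding w_def u_def by (simp add: algebra_simps)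
    also have "norm \<dots> \<le> C3 * q\<^sup>2 * h\<^sup>2 + C4 * Bp\<^sup>2 * h\<^sup>2 + q\<^sup>2 * Bl * h\<^sup>2
        + q * (L * (Bp + T * (C4 * Bp\<^sup>2))) * h\<^sup>2"
      by (intro norm_triangle_mono r1 r2 r3 r4)
    also have "\<dots> = C * h\<^sup>2" by (simp only: C_def distrib_right)
    finally show ?thesis by (simp only: z_def y_def w_def e_def u_def mult_minus_left)
  qed
  ultimately show ?thesis by blast
qed

section \<open>Convergence on the product\<close>

lemma norm_vec_le_sum: "norm X \<le> (\<Sum>i\<in>UNIV. norm (X $ i))"
  unfolding norm_vec_def by (rule L2_set_le_sum) simp

lemma pdist_le:
  fixes X Y :: "real^'m::{finite,enum}^'k"
  assumes "\<And>i. valid_model (g i) CARD('m)" "X \<in> pcarrier g" "Y \<in> pcarrier g"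
  shows "pdist g X Y \<le> 3 * CARD('k) * norm (X - Y)"
proof -
  have "pdist g X Y \<le> (\<Sum>i\<in>(UNIV::'k set). 3 * norm (X - Y))"
    unfolding pdist_def
  proof (rule sum_mono)
    fix i
    have "gdist (g i) (X $ i) (Y $ i) \<le> 3 * norm ((X - Y) $ i)"
      using assms gdist_le[of "g i" "X $ i" "Y $ i"] by (auto simp: pcarrier_def)
    also have "\<dots> \<le> 3 * norm (X - Y)" using Finite_Cartesian_Product.norm_nth_le[of "X - Y" i] by simp
    finally show "gdist (g i) (X $ i) (Y $ i) \<le> 3 * norm (X - Y)" .
  qed
  then show ?thesis by simp
qed

lemma regular_region_factor:
  fixes \<Omega> :: "(real^'m::{finite,enum}^'k) set"
  assumes "\<And>i. valid_model (g i) CARD('m)" "compact \<Omega>" "\<Omega> \<subseteq> pcarrier g" "away_from_cut g \<Omega>"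
  shows "regular_region (g i) ((\<lambda>X. X $ i) ` \<Omega>)"
proof -
  have "compact ((\<lambda>X. X $ i) ` \<Omega>)"
    using assms(2) by (intro compact_continuous_image continuous_intros)
  then show ?thesis
    using assms unfolding regular_region_def away_from_cut_def pcarrier_def by auto
qed

text \<open>Joint dependence matters: the bound in X drives the error recursion, and the bound in t
  makes the velocity of the exact solution Lipschitz in time.\<close>

lemma lipschitz_ode_rhs:
  fixes \<Omega> :: "(real^'m::{finite,enum}^'k) set"
  assumes models: "\<And>i. valid_model (g i) CARD('m)" and "\<And>i. C1_on_PT g T (f i)"
    and \<Omega>: "compact \<Omega>" "\<Omega> \<subseteq> pcarrier g" "away_from_cut g \<Omega>"
  shows "\<exists>L. L-lipschitz_on (\<Omega> \<times> {0..T}) (\<lambda>z. ode_rhs g \<tau> f V (fst z) (snd z))"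
proof (rule ex_lipschitz_on_vec)
  fix i
  let ?K = "\<Omega> \<times> {0..T}"
  have K: "compact ?K" using \<Omega> by (intro compact_Times) auto
  note reg = regular_region_factor[OF models \<Omega>, of i]
  obtain U G where UG: "open U" "pcarrier g \<times> {0..T} \<subseteq> U" "C1_on U G"
    "\<And>X t. X \<in> pcarrier g \<Longrightarrow> t \<in> {0..T} \<Longrightarrow> G (X, t) = f i X t"
    using assms(2)[of i] unfolding C1_on_PT_def by blast
  \<comment> \<open>The derivative exists for the extension \<open>G\<close> on an open set; the
    bound for \<open>f i\<close> is inherited by restriction.\<close>
  have "\<exists>L. L-lipschitz_on ?K G"
    using UG(1,2) K \<Omega>(2) by (intro C1_lipschitz_on_compact[OF UG(3)]) auto
  then have f: "\<exists>L. L-lipschitz_on ?K (\<lambda>z. f i (fst z) (snd z))"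
    by (rule ex_lipschitz_on_cong) (use UG(4) \<Omega>(2) in auto)
  have pr: "\<exists>L. L-lipschitz_on ?K (\<lambda>z. fst z $ i)"
    by (intro ex_lipschitz_on_linear bounded_linear_compose[OF bounded_linear_vec_nth bounded_linear_fst])
  have sub: "(\<lambda>z. fst z $ i) ` ?K \<subseteq> (\<lambda>X. X $ i) ` \<Omega>" by auto
  have "\<exists>L. L-lipschitz_on ?K (\<lambda>z.
      (1 / \<tau> i + f i (fst z) (snd z)) *\<^sub>R rlog (g i) (fst z $ i) (origin (g i))
      + f i (fst z) (snd z) *\<^sub>R ptrans (g i) (origin (g i)) (fst z $ i) (V $ i))"
    using f K ex_lipschitz_on_compose[OF lipschitz_rlog_origin[OF reg] pr sub]
      ex_lipschitz_on_compose[OF lipschitz_ptrans_origin[OF reg] pr sub]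
    by (intro ex_lipschitz_intros compact_imp_bounded)
  then show "\<exists>L. L-lipschitz_on ?K (\<lambda>z. ode_rhs g \<tau> f V (fst z) (snd z) $ i)"
    by (simp add: ode_rhs_def)
qed

lemma gd_step_remainder:
  fixes \<Omega> :: "(real^'m::{finite,enum}^'k) set"
  assumes models: "\<And>i. valid_model (g i) CARD('m)" and tau: "\<And>i. \<tau> i > 0" and "T > 0"
    and V: "\<And>i. V $ i \<in> tangent (g i) (origin (g i))"
    and f_range: "\<And>i X t. X \<in> pcarrier g \<Longrightarrow> t \<in> {0..T} \<Longrightarrow> f i X t \<in> {0..1}"
    and \<Omega>: "compact \<Omega>" "\<Omega> \<subseteq> pcarrier g" "away_from_cut g \<Omega>"
  shows "\<exists>C\<ge>0. \<forall>X\<in>\<Omega>. \<forall>h\<in>{0..T}. \<forall>t\<in>{0..T}. gd_mid g f V h X t \<in> \<Omega> \<longrightarrow>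
    norm (gd_step g \<tau> f V h X t - X - h *\<^sub>R ode_rhs g \<tau> f V X t) \<le> C * h\<^sup>2"
proof -
  let ?S = "\<lambda>i. (\<lambda>X. X $ i) ` \<Omega>"
  have "\<forall>i. \<exists>C\<ge>0. \<forall>x\<in>?S i. \<forall>h\<in>{0..T}. \<forall>a\<in>{0..1}.
    rexp (g i) x (h *\<^sub>R a *\<^sub>R ptrans (g i) (origin (g i)) x (V $ i)) \<in> ?S i \<longrightarrow>
    norm (rexp (g i) (origin (g i)) (exp (- h * (1 / \<tau> i + a)) *\<^sub>R
        rlog (g i) (origin (g i)) (rexp (g i) x (h *\<^sub>R a *\<^sub>R ptrans (g i) (origin (g i)) x (V $ i))))
      - x - h *\<^sub>R ((1 / \<tau> i + a) *\<^sub>R rlog (g i) x (origin (g i))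
      + a *\<^sub>R ptrans (g i) (origin (g i)) x (V $ i))) \<le> C * h\<^sup>2"
    using tau \<open>T > 0\<close>
    by (intro allI gd_step_factor_remainder regular_region_factor models \<Omega> V) (auto intro: less_imp_le)
  then obtain C where C0: "\<And>i. C i \<ge> 0" and C: "\<And>i x h a. x \<in> ?S i \<Longrightarrow> h \<in> {0..T} \<Longrightarrow> a \<in> {0..1} \<Longrightarrow>
    rexp (g i) x (h *\<^sub>R a *\<^sub>R ptrans (g i) (origin (g i)) x (V $ i)) \<in> ?S i \<Longrightarrow>
    norm (rexp (g i) (origin (g i)) (exp (- h * (1 / \<tau> i + a)) *\<^sub>R
        rlog (g i) (origin (g i)) (rexp (g i) x (h *\<^sub>R a *\<^sub>R ptrans (g i) (origin (g i)) x (V $ i))))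
      - x - h *\<^sub>R ((1 / \<tau> i + a) *\<^sub>R rlog (g i) x (origin (g i))
      + a *\<^sub>R ptrans (g i) (origin (g i)) x (V $ i))) \<le> C i * h\<^sup>2"
    by metis
  have "norm (gd_step g \<tau> f V h X t - X - h *\<^sub>R ode_rhs g \<tau> f V X t) \<le> (\<Sum>i\<in>UNIV. C i) * h\<^sup>2"
    if X: "X \<in> \<Omega>" "h \<in> {0..T}" "t \<in> {0..T}" "gd_mid g f V h X t \<in> \<Omega>" for X h t
  proof -
    have mid: "gd_mid g f V h X t $ i
        = rexp (g i) (X $ i) (h *\<^sub>R f i X t *\<^sub>R ptrans (g i) (origin (g i)) (X $ i) (V $ i))" for i
      by (simp add: gd_mid_def pexp_def odot_def ptransP_def porigin_def)
    have "norm ((gd_step g \<tau> f V h X t - X - h *\<^sub>R ode_rhs g \<tau> f V X t) $ i) \<le> C i * h\<^sup>2" for i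
    proof -
      have "rexp (g i) (X $ i) (h *\<^sub>R f i X t *\<^sub>R ptrans (g i) (origin (g i)) (X $ i) (V $ i)) \<in> ?S i"
        using X(4) mid[of i] by (metis image_eqI)
      from C[OF _ X(2) _ this] f_range[of X t i] X \<Omega>(2) show ?thesis
        by (auto simp: gd_step_def pexp_def odot_def plog_def porigin_def mid ode_rhs_def)
    qed
    then have "(\<Sum>i\<in>UNIV. norm ((gd_step g \<tau> f V h X t - X - h *\<^sub>R ode_rhs g \<tau> f V X t) $ i))
        \<le> (\<Sum>i\<in>UNIV. C i * h\<^sup>2)" by (intro sum_mono)
    with norm_vec_le_sum show ?thesis unfolding sum_distrib_right by (rule order_trans)
  qed
  moreover have "(\<Sum>i\<in>UNIV. C i) \<ge> 0" using C0 by (intro sum_nonneg)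
  ultimately show ?thesis by blast
qed

text \<open>A bootstrap: the bounded velocity makes \<open>x\<close> Lipschitz, hence
  \<open>F (x t, t)\<close> is Lipschitz in t, and the solution has the Lipschitz derivative that a
  quadratic remainder requires.\<close>

lemma solution_remainder:
  fixes F :: "'a::real_normed_vector \<times> real \<Rightarrow> 'a"
  assumes F: "L-lipschitz_on (\<Omega> \<times> {0..T}) F" and "bounded \<Omega>"
    and ode: "\<And>t. t \<in> {0..T} \<Longrightarrow> (x has_vector_derivative F (x t, t)) (at t within {0..T})"
    and x: "\<And>t. t \<in> {0..T} \<Longrightarrow> x t \<in> \<Omega>"
  shows "\<exists>C\<ge>0. \<forall>t\<in>{0..T}. \<forall>s\<in>{0..T}. norm (x s - x t - (s - t) *\<^sub>R F (x t, t)) \<le> C * (s - t)\<^sup>2"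
proof -
  have "bounded (\<Omega> \<times> {0..T})" using assms(2) by (intro bounded_Times) auto
  then obtain B where B: "B \<ge> 0" "\<And>z. z \<in> \<Omega> \<times> {0..T} \<Longrightarrow> norm (F z) \<le> B"
    using lipschitz_on_bounded_image[OF F] by blast
  have "B-lipschitz_on {0..T} x"
  proof (rule bounded_derivative_imp_lipschitz)
    show "(x has_derivative (\<lambda>h. h *\<^sub>R F (x u, u))) (at u within {0..T})" if "u \<in> {0..T}" for u
      using ode[OF that] by (simp add: has_vector_derivative_def)
    show "onorm (\<lambda>h. h *\<^sub>R F (x u, u)) \<le> B" if "u \<in> {0..T}" for u
      using B(2)[of "(x u, u)"] x that
      by (intro onorm_le) (auto simp: mult.commute[of _ "\<bar>_\<bar>"] intro!: mult_left_mono)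
  qed (use B in auto)
  from lipschitz_on_Pair[OF this lipschitz_on_id]
  have pair: "\<exists>L. L-lipschitz_on {0..T} (\<lambda>t. (x t, t))" by (rule exI)
  have "\<exists>L. L-lipschitz_on (\<Omega> \<times> {0..T}) F" using F by (rule exI)
  moreover have "(\<lambda>t. (x t, t)) ` {0..T} \<subseteq> \<Omega> \<times> {0..T}" using x by auto
  ultimately have "\<exists>L. L-lipschitz_on {0..T} (\<lambda>t. F (x t, t))"
    by (rule ex_lipschitz_on_compose[OF _ pair])
  then obtain C where C: "C-lipschitz_on {0..T} (\<lambda>t. F (x t, t))" by blast
  have "norm (x s - x t - (s - t) *\<^sub>R F (x t, t)) \<le> C * (s - t)\<^sup>2" if "t \<in> {0..T}" "s \<in> {0..T}" for s t
    using that by (intro remainder_bound_lipschitz_derivative[OF ode C])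
      (auto simp: closed_segment_eq_real_ivl)
  then show ?thesis using lipschitz_on_nonneg[OF C] by blast
qed

theorem theorem1:
  fixes g :: "'k::finite \<Rightarrow> model"
    and \<tau> :: "'k \<Rightarrow> real"
    and V x0 :: "real^'m::{finite,enum}^'k"
    and f :: "'k \<Rightarrow> real^'m::{finite,enum}^'k \<Rightarrow> real \<Rightarrow> real"
    and T :: real
    and x :: "real \<Rightarrow> real^'m::{finite,enum}^'k"
    and \<Omega> :: "(real^'m::{finite,enum}^'k) set"
  assumes models: "\<And>i. valid_model (g i) CARD('m::{finite,enum})"
    and tau_pos: "\<And>i. \<tau> i > 0"
    and V_tan: "\<And>i. V $ i \<in> tangent (g i) (origin (g i))"
    and T_pos: "T > 0"
    and f_range: "\<And>i X t. X \<in> pcarrier g \<Longrightarrow> t \<in> {0..T} \<Longrightarrow> f i X t \<in> {0..1}"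
    and f_C1: "\<And>i. C1_on_PT g T (f i)"
    and x0_in: "x0 \<in> pcarrier g"
    and sol_in: "\<And>t. t \<in> {0..T} \<Longrightarrow> x t \<in> pcarrier g"
    and sol_init: "x 0 = x0"
    and sol_ode: "\<And>t. t \<in> {0..T} \<Longrightarrow>
        (x has_vector_derivative ode_rhs g \<tau> f V (x t) t) (at t within {0..T})"
    and Omega_compact: "compact \<Omega>"
    and Omega_sub: "\<Omega> \<subseteq> pcarrier g"
    and Omega_cut: "away_from_cut g \<Omega>"
    and sol_Omega: "\<And>t. t \<in> {0..T} \<Longrightarrow> x t \<in> \<Omega>"
    and iter_Omega: "\<And>N j. N > 0 \<Longrightarrow> j \<le> N \<Longrightarrow> gd_iter g \<tau> f V T N x0 j \<in> \<Omega>"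
    and mid_Omega: "\<And>N j. N > 0 \<Longrightarrow> j < N \<Longrightarrow>
        gd_mid g f V (T / real N) (gd_iter g \<tau> f V T N x0 j) (real j * (T / real N)) \<in> \<Omega>"
  shows "\<exists>C h0. C > 0 \<and> h0 > 0 \<and>
           (\<forall>N::nat. N > 0 \<longrightarrow> T / real N \<le> h0 \<longrightarrow>
              (\<forall>j\<le>N. pdist g (gd_iter g \<tau> f V T N x0 j) (x (real j * (T / real N)))
                        \<le> C * (T / real N)))"
proof -
  let ?F = "\<lambda>z. ode_rhs g \<tau> f V (fst z) (snd z)"
  obtain L where L: "L-lipschitz_on (\<Omega> \<times> {0..T}) ?F"
    using lipschitz_ode_rhs[where f = f, OF models f_C1 Omega_compact Omega_sub Omega_cut] by blast
  have L0: "L \<ge> 0" using L by (rule lipschitz_on_nonneg)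
  obtain C1 where C1: "C1 \<ge> 0" "\<And>X h t. X \<in> \<Omega> \<Longrightarrow> h \<in> {0..T} \<Longrightarrow> t \<in> {0..T} \<Longrightarrow>
      gd_mid g f V h X t \<in> \<Omega> \<Longrightarrow>
      norm (gd_step g \<tau> f V h X t - X - h *\<^sub>R ode_rhs g \<tau> f V X t) \<le> C1 * h\<^sup>2"
    using gd_step_remainder[where f = f and \<tau> = \<tau>, OF models tau_pos T_pos V_tan f_range
        Omega_compact Omega_sub Omega_cut]
    by blast
  have "\<exists>C\<ge>0. \<forall>t\<in>{0..T}. \<forall>s\<in>{0..T}. norm (x s - x t - (s - t) *\<^sub>R ?F (x t, t)) \<le> C * (s - t)\<^sup>2"
    using solution_remainder[OF L compact_imp_bounded[OF Omega_compact]] sol_ode sol_Omega by simp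
  then obtain C2 where C2: "C2 \<ge> 0" "\<And>t s. t \<in> {0..T} \<Longrightarrow> s \<in> {0..T} \<Longrightarrow>
      norm (x s - x t - (s - t) *\<^sub>R ode_rhs g \<tau> f V (x t) t) \<le> C2 * (s - t)\<^sup>2"
    by auto
  \<comment> \<open>The factor \<open>3 * CARD('k)\<close> converts the ambient norm into
    \<open>pdist\<close>; the rest is the Gronwall bound with local error (C1 + C2) h^2 and j h <=
    T.\<close>
  define D where "D = 3 * CARD('k) * (T * (C1 + C2) * exp (L * T))"
  have D: "D \<ge> 0" using T_pos C1 C2 by (simp add: D_def)
  have main: "pdist g (gd_iter g \<tau> f V T N x0 j) (x (real j * (T / real N))) \<le> (D + 1) * (T / real N)"
    if N: "N > 0" and j: "j \<le> N" for N j
  proof -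
    define h where "h = T / real N"
    define X where "X j = gd_iter g \<tau> f V T N x0 j" for j
    define e where "e j = norm (X j - x (real j * h))" for j
    have h: "h > 0" "h \<in> {0..T}" using N T_pos by (auto simp: h_def divide_le_eq)
    have jh: "real j * h \<in> {0..T}" if "j \<le> N" for j
    proof -
      have "real j * h \<le> real N * h" using that h by (intro mult_right_mono) auto
      then show ?thesis using N h by (simp add: h_def)
    qed
    have step: "e (Suc j) \<le> (1 + L * h) * e j + (C1 + C2) * h\<^sup>2" if j: "j < N" for j
    proof -
      define t where "t = real j * h"
      have t: "t \<in> {0..T}" "t + h \<in> {0..T}"
        using jh[of j] jh[of "Suc j"] j by (auto simp: t_def algebra_simps)
      have XO: "X j \<in> \<Omega>" using iter_Omega[OF N] j by (simp add: X_def)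
      have XS: "X (Suc j) = gd_step g \<tau> f V h (X j) t" by (simp add: X_def h_def t_def)
      let ?G = "ode_rhs g \<tau> f V"
      have a: "norm (X (Suc j) - X j - h *\<^sub>R ?G (X j) t) \<le> C1 * h\<^sup>2"
        unfolding XS using XO h t mid_Omega[OF N j] by (intro C1(2)) (auto simp: X_def t_def h_def)
      have b: "norm (x t + h *\<^sub>R ?G (x t) t - x (t + h)) \<le> C2 * h\<^sup>2"
        using C2(2)[OF t] by (simp add: norm_minus_commute algebra_simps)
      have "norm (?G (X j) t - ?G (x t) t) \<le> L * norm (X j - x t)"
        using lipschitz_onD[OF L, of "(X j, t)" "(x t, t)"] XO t sol_Omega[OF t(1)]
        by (simp add: dist_Pair_Pair dist_norm)
      then have c: "norm (h *\<^sub>R (?G (X j) t - ?G (x t) t)) \<le> h * (L * norm (X j - x t))"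
        unfolding norm_scaleR using h by (simp add: mult_left_mono)
      \<comment> \<open>Local errors of scheme and solution against their own Euler steps, then the
        difference of the two Euler steps, where the Lipschitz bound of the field enters.\<close>
      have "X (Suc j) - x (t + h) = (X (Suc j) - X j - h *\<^sub>R ?G (X j) t)
          + (x t + h *\<^sub>R ?G (x t) t - x (t + h)) + h *\<^sub>R (?G (X j) t - ?G (x t) t) + (X j - x t)"
        by (simp add: algebra_simps)
      also have "norm \<dots> \<le> C1 * h\<^sup>2 + C2 * h\<^sup>2 + h * (L * norm (X j - x t)) + norm (X j - x t)"
        by (intro norm_triangle_mono a b c order_refl)
      finally show ?thesis by (simp add: e_def t_def algebra_simps)
    qed
    have "e 0 \<le> 0" by (simp add: e_def X_def sol_init)
    then have "e j \<le> real j * ((C1 + C2) * h\<^sup>2) * exp (L * h * real j)"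
      using discrete_gronwall[where e = e, OF L0 _ _ _ step j] h C1 C2 by simp
    also have "\<dots> = (real j * h) * ((C1 + C2) * h) * exp (L * (real j * h))"
      by (simp add: power2_eq_square mult_ac)
    also have "\<dots> \<le> T * ((C1 + C2) * h) * exp (L * T)"
      using jh[OF j] h C1 C2 L0 T_pos by (intro mult_mono) (auto intro: mult_left_mono)
    finally have ej: "e j \<le> T * ((C1 + C2) * h) * exp (L * T)" .
    have "pdist g (X j) (x (real j * h)) \<le> 3 * CARD('k) * e j"
      unfolding e_def
      using models iter_Omega[OF N j] Omega_sub sol_in[OF jh[OF j]] by (intro pdist_le) (auto simp: X_def)
    also have "\<dots> \<le> 3 * CARD('k) * (T * ((C1 + C2) * h) * exp (L * T))"
      using ej by (intro mult_left_mono) auto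
    also have "\<dots> = D * h" by (simp add: D_def mult_ac)
    also have "\<dots> \<le> (D + 1) * h" using h by (simp add: algebra_simps)
    finally show ?thesis by (simp add: X_def h_def)
  qed
  \<comment> \<open>\<open>main\<close> holds for every positive \<open>N\<close>, so 1 is an
    arbitrary threshold; \<open>D + 1\<close> is positive even when \<open>D\<close> is 0.\<close>
  show ?thesis
    using D main by (intro exI[of _ "D + 1"] exI[of _ 1]) auto
qed

end
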